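(* Let $(M,d)$ be a complete separable metric space with a Radon probability measure $\mu$ such that $(M,d,\mu)$ satisfies the transportation inequality $T_2(\alpha)$ for some $\alpha>0$. Let $N\in\mathbb N$, let $(M^N,\ell^2(d),\mu^{\otimes N})$ be the direct product metric probability space, and for $\xi=(\xi_j)_{j=1}^N\in M^N$ let $L_N^\xi=N^{-1}\sum_{j=1}^N\delta_{\xi_j}$ be the empirical distribution, where the $\xi_j$ are independent and distributed as $\mu$. Then for $p=1,2$, $$\mu^{\otimes N}\Big(\Big\{\xi\in M^N:\big|W_p(L_N^\xi,\mu)-\mathbb EW_p(L_N,\mu)\big|>\varepsilon\Big\}\Big)\le2e^{-N\alpha\varepsilon^2/2}\qquad(\varepsilon>0),$$ where $\mathbb EW_p(L_N,\mu)=\int_{M^N}W_p(L_N^\xi,\mu)\,\mu^{\otimes N}(d\xi)$.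
   Context: $W_p$ is the Wasserstein distance of order $p$ for the metric $d$: $W_p(\nu,\mu)^p=\inf_\pi\iint d(x,y)^p\,\pi(dx\,dy)$ over couplings $\pi$ of $\nu$ and $\mu$. $\ell^2(d)$ is the metric $\big(\sum_{j=1}^Nd(x_j,y_j)^2\big)^{1/2}$ on $M^N$. $(M,d,\mu)$ satisfies $T_2(\alpha)$ if $$W_2(\nu,\mu)^2\le\frac2\alpha\,\mathrm{Ent}(\nu\mid\mu)$$ for all probability measures $\nu$ of finite relative entropy $\mathrm{Ent}(\nu\mid\mu)=\int\log\frac{d\nu}{d\mu}\,d\nu$ with respect to $\mu$. *)

theory Defs
  imports "HOL-Probability.Probability"
begin

definition radon_prob :: "'a::topological_space measure \<Rightarrow> bool" where
  "radon_prob \<mu> \<longleftrightarrow> prob_space \<mu> \<and> sets \<mu> = sets borel \<and>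
     (\<forall>A\<in>sets \<mu>. emeasure \<mu> A = (SUP K\<in>{K. K \<subseteq> A \<and> compact K}. emeasure \<mu> K))"

definition couplings :: "'a measure \<Rightarrow> 'b measure \<Rightarrow> ('a \<times> 'b) measure set" where
  "couplings \<nu> \<mu> = {\<pi>. sets \<pi> = sets (\<nu> \<Otimes>\<^sub>M \<mu>) \<and> distr \<pi> \<nu> fst = \<nu> \<and> distr \<pi> \<mu> snd = \<mu>}"

definition transport_cost ::
    "real \<Rightarrow> 'a::metric_space measure \<Rightarrow> 'a measure \<Rightarrow> ennreal" where
  "transport_cost p \<nu> \<mu> =
     (INF \<pi>\<in>couplings \<nu> \<mu>. \<integral>\<^sup>+ z. ennreal (dist (fst z) (snd z) powr p) \<partial>\<pi>)"

(* The p-th root of the cost, with an infinite cost giving an infinite distance: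
   powr is not available on ennreal and enn2real sends top to 0. *)
definition wasserstein ::
    "real \<Rightarrow> 'a::metric_space measure \<Rightarrow> 'a measure \<Rightarrow> ennreal" where
  "wasserstein p \<nu> \<mu> =
     (if transport_cost p \<nu> \<mu> = \<top> then \<top>
      else ennreal (enn2real (transport_cost p \<nu> \<mu>) powr (1 / p)))"

(* The positive part of log (d\<nu>/d\<mu>) may fail to be \<nu>-integrable, the negative part cannot,
   so integrability of the entropy density says exactly that Ent(\<nu>|\<mu>) is finite. *)
definition finite_relative_entropy :: "'a measure \<Rightarrow> 'a measure \<Rightarrow> bool" where
  "finite_relative_entropy \<nu> \<mu> \<longleftrightarrow>
     absolutely_continuous \<mu> \<nu> \<and> integrable \<nu> (entropy_density (exp 1) \<mu> \<nu>)"

(* The library takes the reference measure first and the base of the logarithm explicitly. *)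
definition relative_entropy :: "'a measure \<Rightarrow> 'a measure \<Rightarrow> real" where
  "relative_entropy \<nu> \<mu> = KL_divergence (exp 1) \<mu> \<nu>"

definition transport_T2 :: "real \<Rightarrow> 'a::metric_space measure \<Rightarrow> bool" where
  "transport_T2 \<alpha> \<mu> \<longleftrightarrow>
     (\<forall>\<nu>. prob_space \<nu> \<and> sets \<nu> = sets \<mu> \<and> finite_relative_entropy \<nu> \<mu> \<longrightarrow>
        (wasserstein 2 \<nu> \<mu>)\<^sup>2 \<le> ennreal (2 / \<alpha> * relative_entropy \<nu> \<mu>))"

definition empirical :: "nat \<Rightarrow> (nat \<Rightarrow> 'a::topological_space) \<Rightarrow> 'a measure" where
  "empirical N \<xi> = measure_of UNIV (sets borel)
     (\<lambda>A. (\<Sum>j=1..N. emeasure (return borel (\<xi> j)) A) / of_nat N)"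

(* measure_of yields the zero measure unless its argument is countably additive. *)
lemma emeasure_empirical:
  assumes "A \<in> sets borel"
  shows "emeasure (empirical N \<xi>) A = (\<Sum>j=1..N. emeasure (return borel (\<xi> j)) A) / of_nat N"
  unfolding empirical_def
proof (rule emeasure_measure_of_sigma)
  show "sigma_algebra UNIV (sets (borel :: 'a measure))"
    using sets.sigma_algebra_axioms[of "borel :: 'a measure"] by simp
  show "positive (sets borel) (\<lambda>A. (\<Sum>j=1..N. emeasure (return borel (\<xi> j)) A) / of_nat N)"
    by (simp add: positive_def)
  show "countably_additive (sets borel)
          (\<lambda>A. (\<Sum>j=1..N. emeasure (return borel (\<xi> j)) A) / of_nat N)"
  proof (rule countably_additiveI)
    fix F :: "nat \<Rightarrow> 'a set"
    assume F: "range F \<subseteq> sets borel" "disjoint_family F" "\<Union> (range F) \<in> sets borel"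
    have "(\<Sum>i. (\<Sum>j=1..N. emeasure (return borel (\<xi> j)) (F i)) / of_nat N)
        = (\<Sum>i. \<Sum>j=1..N. emeasure (return borel (\<xi> j)) (F i)) / of_nat N"
      by simp
    also have "(\<Sum>i. \<Sum>j=1..N. emeasure (return borel (\<xi> j)) (F i))
        = (\<Sum>j=1..N. \<Sum>i. emeasure (return borel (\<xi> j)) (F i))"
      by (rule suminf_sum) auto
    also have "\<dots> = (\<Sum>j=1..N. emeasure (return borel (\<xi> j)) (\<Union> (range F)))"
      using F by (intro sum.cong refl suminf_emeasure) auto
    finally show "(\<Sum>i. (\<Sum>j=1..N. emeasure (return borel (\<xi> j)) (F i)) / of_nat N)
        = (\<Sum>j=1..N. emeasure (return borel (\<xi> j)) (\<Union> (range F))) / of_nat N" .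
  qed
qed (use assms in auto)

end

theory Submission
  imports Defs
begin

text \<open>
  The function \<open>W \<xi> = W\<^sub>p (L\<^sub>N\<^sup>\<xi>, \<mu>)\<close> is Lipschitz with constant \<open>1 / sqrt N\<close> for the metric
  \<open>\<ell>\<^sup>2(d)\<close>, and \<open>T\<^sub>2\<close> gives Gaussian concentration, with the same \<open>\<alpha>\<close> in every dimension, for
  functions that are Lipschitz with respect to \<open>\<ell>\<^sup>2(d)\<close>.

  Concentration is obtained from a dual form of \<open>T\<^sub>2\<close> (\<open>transport_T2_dual\<close>): if \<open>f\<close> and \<open>g\<close>
  are bounded and measurable with \<open>f x \<le> g y + d(x,y)\<^sup>2\<close> for all \<open>x\<close> and \<open>y\<close>, then
  \<open>\<integral> exp (\<alpha>/2 f) d\<mu> \<le> exp (\<alpha>/2 \<integral> g d\<mu>)\<close>. It follows by applying \<open>T\<^sub>2\<close> to the measure \<open>\<nu>\<close> with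
  density proportional to \<open>exp (\<alpha>/2 f)\<close>: integrating the hypothesis against any coupling bounds
  \<open>\<integral> f d\<nu> - \<integral> g d\<mu>\<close> by the transport cost, hence by the entropy. In this two-function form the
  inequality passes to products (\<open>transport_T2_dual_PiM\<close>) by Fubini alone: integrating out one
  coordinate turns a pair \<open>(f, g)\<close> on the product into the pair
  \<open>(2/\<alpha> log \<integral> exp (\<alpha>/2 f), \<integral> g)\<close> with one coordinate less. No infimum convolution has to be
  shown measurable. For a Lipschitz function \<open>F\<close> with constant \<open>L\<close>, the choice \<open>g = s F\<close> and
  \<open>f = s F - s\<^sup>2 L\<^sup>2 / 4\<close> with \<open>s = 2 t / \<alpha>\<close> yields
  \<open>\<integral> exp (t F) \<le> exp (t \<integral> F + t\<^sup>2 L\<^sup>2 / (2 \<alpha>))\<close> (\<open>lipschitz_exp_moment\<close>), and Chernoff's bound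
  concludes.

  For the Lipschitz estimate (\<open>wasserstein_empirical_le\<close>), couplings of an empirical measure with
  \<open>\<mu>\<close> are replaced by couplings \<open>\<sigma>\<close> of the uniform distribution on the indices \<open>1, \<dots>, N\<close> with
  \<open>\<mu>\<close> (\<open>transport_cost_empirical\<close>). The set of such \<open>\<sigma>\<close> does not depend on \<open>\<xi>\<close>, so \<open>W\<close> is an
  infimum of the \<open>L\<^sup>p(\<sigma>)\<close> norms of \<open>(j, y) \<mapsto> d(\<xi>\<^sub>j, y)\<close>, and the triangle inequality in
  \<open>L\<^sup>p(\<sigma>)\<close> takes the place of a gluing argument. Finiteness and integrability of \<open>W\<close> come
  from the second moment of \<open>\<mu>\<close>, which is finite by \<open>T\<^sub>2\<close> (\<open>transport_T2_second_moment\<close>).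
\<close>

section \<open>Relative entropy and couplings\<close>

lemma wasserstein_2_squared: "(wasserstein 2 \<nu> \<mu>)\<^sup>2 = transport_cost 2 \<nu> \<mu>"
proof (cases "transport_cost 2 \<nu> \<mu> = \<top>")
  case True
  then show ?thesis by (simp add: wasserstein_def)
next
  case False
  define c where "c = enn2real (transport_cost 2 \<nu> \<mu>)"
  have "(wasserstein 2 \<nu> \<mu>)\<^sup>2 = ennreal ((c powr (1/2))\<^sup>2)"
    using False by (simp add: wasserstein_def c_def ennreal_power)
  also have "(c powr (1/2))\<^sup>2 = c"
    by (simp add: powr_half_sqrt c_def)
  finally show ?thesis
    using False by (simp add: c_def less_top)
qed

text \<open>
  The bound on \<open>ln (f x)\<close> may include points where \<open>f\<close> vanishes, since \<open>ln 0 = 0\<close>. The lemma is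
  used both for a positive density and for a normalized indicator function.
\<close>
lemma relative_entropy_density:
  fixes f :: "'a \<Rightarrow> real"
  assumes "prob_space \<mu>" and [measurable]: "f \<in> borel_measurable \<mu>"
    and "\<And>x. 0 \<le> f x" and "prob_space (density \<mu> f)" and ln_le: "\<And>x. \<bar>ln (f x)\<bar> \<le> B"
  shows "finite_relative_entropy (density \<mu> f) \<mu>"
    and "relative_entropy (density \<mu> f) \<mu> = (\<integral>x. ln (f x) \<partial>density \<mu> f)"
    and "0 \<le> (\<integral>x. ln (f x) \<partial>density \<mu> f)"
proof -
  interpret prob_space \<mu> by fact
  interpret N: prob_space "density \<mu> f" by fact
  let ?e = "entropy_density (exp 1) \<mu> (density \<mu> f)"
  have ac: "absolutely_continuous \<mu> (density \<mu> f)"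
    by (rule absolutely_continuousI_density) measurable
  have "AE x in \<mu>. f x = RN_deriv \<mu> (density \<mu> f) x"
    by (rule RN_deriv_unique) auto
  then have "AE x in \<mu>. ?e x = ln (f x)"
  proof eventually_elim
    case (elim x)
    then have "enn2real (RN_deriv \<mu> (density \<mu> f) x) = f x"
      using assms(3)[of x] by (metis enn2real_ennreal)
    then show ?case by (simp add: entropy_density_def log_def)
  qed
  then have eq: "AE x in density \<mu> f. ?e x = ln (f x)"
    using absolutely_continuous_AE[OF _ ac] by simp
  have int: "integrable (density \<mu> f) (\<lambda>x. ln (f x))"
    by (rule N.integrable_const_bound[where B = B]) (use ln_le in auto)
  have [measurable]: "?e \<in> borel_measurable (density \<mu> f)"
    using measurable_entropy_density[of "exp 1" \<mu>] by simp
  have "integrable (density \<mu> f) ?e"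
    using eq by (subst integrable_cong_AE[of _ _ "\<lambda>x. ln (f x)"]) (use int in auto)
  with ac show "finite_relative_entropy (density \<mu> f) \<mu>"
    by (simp add: finite_relative_entropy_def)
  show *: "relative_entropy (density \<mu> f) \<mu> = (\<integral>x. ln (f x) \<partial>density \<mu> f)"
    unfolding relative_entropy_def KL_divergence_def using eq by (intro integral_cong_AE) auto
  interpret information_space \<mu> "exp 1" by standard simp
  have "integrable \<mu> (\<lambda>x. f x * log (exp 1) (f x))"
    using int assms(3) by (simp add: log_def integrable_real_density)
  then have "0 \<le> KL_divergence (exp 1) \<mu> (density \<mu> f)"
    using assms(3) N.prob_space_axioms by (intro KL_nonneg) auto
  then show "0 \<le> (\<integral>x. ln (f x) \<partial>density \<mu> f)"
    unfolding relative_entropy_def[symmetric] * .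
qed

lemma transport_T2_density:
  fixes f :: "'a::metric_space \<Rightarrow> real"
  assumes "transport_T2 \<alpha> \<mu>" and "prob_space \<mu>" and "f \<in> borel_measurable \<mu>"
    and "\<And>x. 0 \<le> f x" and "prob_space (density \<mu> f)" and "\<And>x. \<bar>ln (f x)\<bar> \<le> B"
  shows "transport_cost 2 (density \<mu> f) \<mu>
    \<le> ennreal (2 / \<alpha> * (\<integral>x. ln (f x) \<partial>density \<mu> f))"
  using assms(1,5) relative_entropy_density(1,2)[OF assms(2-6)]
  by (auto simp: transport_T2_def wasserstein_2_squared)

lemma sets_coupling: "\<pi> \<in> couplings \<nu> \<mu> \<Longrightarrow> sets \<pi> = sets (\<nu> \<Otimes>\<^sub>M \<mu>)"
  by (simp add: couplings_def)

lemma coupling_nn_integral: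
  assumes "\<pi> \<in> couplings \<nu> \<mu>"
  shows "f \<in> borel_measurable \<nu> \<Longrightarrow> (\<integral>\<^sup>+z. f (fst z) \<partial>\<pi>) = (\<integral>\<^sup>+x. f x \<partial>\<nu>)"
    and "g \<in> borel_measurable \<mu> \<Longrightarrow> (\<integral>\<^sup>+z. g (snd z) \<partial>\<pi>) = (\<integral>\<^sup>+x. g x \<partial>\<mu>)"
proof -
  have [measurable_cong]: "sets \<pi> = sets (\<nu> \<Otimes>\<^sub>M \<mu>)" and d: "distr \<pi> \<nu> fst = \<nu>" "distr \<pi> \<mu> snd = \<mu>"
    using assms by (auto simp: couplings_def)
  show "(\<integral>\<^sup>+z. f (fst z) \<partial>\<pi>) = (\<integral>\<^sup>+x. f x \<partial>\<nu>)" if "f \<in> borel_measurable \<nu>"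
    using nn_integral_distr[of fst \<pi> \<nu> f] that d(1) by simp
  show "(\<integral>\<^sup>+z. g (snd z) \<partial>\<pi>) = (\<integral>\<^sup>+x. g x \<partial>\<mu>)" if "g \<in> borel_measurable \<mu>"
    using nn_integral_distr[of snd \<pi> \<mu> g] that d(2) by simp
qed

lemma coupling_integral:
  fixes f g :: "_ \<Rightarrow> real"
  assumes "\<pi> \<in> couplings \<nu> \<mu>"
  shows "f \<in> borel_measurable \<nu> \<Longrightarrow> (\<integral>z. f (fst z) \<partial>\<pi>) = (\<integral>x. f x \<partial>\<nu>)"
    and "g \<in> borel_measurable \<mu> \<Longrightarrow> (\<integral>z. g (snd z) \<partial>\<pi>) = (\<integral>x. g x \<partial>\<mu>)"
proof -
  have [measurable_cong]: "sets \<pi> = sets (\<nu> \<Otimes>\<^sub>M \<mu>)" and d: "distr \<pi> \<nu> fst = \<nu>" "distr \<pi> \<mu> snd = \<mu>"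
    using assms by (auto simp: couplings_def)
  show "(\<integral>z. f (fst z) \<partial>\<pi>) = (\<integral>x. f x \<partial>\<nu>)" if "f \<in> borel_measurable \<nu>"
    using integral_distr[of fst \<pi> \<nu> f] that d(1) by simp
  show "(\<integral>z. g (snd z) \<partial>\<pi>) = (\<integral>x. g x \<partial>\<mu>)" if "g \<in> borel_measurable \<mu>"
    using integral_distr[of snd \<pi> \<mu> g] that d(2) by simp
qed

lemma coupling_prob_space:
  assumes "\<pi> \<in> couplings \<nu> \<mu>" and "prob_space \<nu>"
  shows "prob_space \<pi>"
proof (rule prob_spaceI)
  interpret \<nu>: prob_space \<nu> by fact
  show "emeasure \<pi> (space \<pi>) = 1"
    using coupling_nn_integral(1)[OF assms(1), of "\<lambda>_. 1"] by (simp add: \<nu>.emeasure_space_1)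
qed

section \<open>The dual form of the transport inequality\<close>

text \<open>
  The easy half of Kantorovich duality for the cost \<open>d\<^sup>2\<close>.
\<close>
lemma coupling_gain_le_transport_cost:
  fixes \<nu> \<mu> :: "'a::polish_space measure" and f g :: "'a \<Rightarrow> real"
  assumes "prob_space \<nu>" "prob_space \<mu>" "sets \<nu> = sets borel" "sets \<mu> = sets borel"
    and [measurable]: "f \<in> borel_measurable borel" "g \<in> borel_measurable borel"
    and "\<And>x. \<bar>f x\<bar> \<le> B" "\<And>x. \<bar>g x\<bar> \<le> B"
    and fg: "\<And>x y. f x \<le> g y + (dist x y)\<^sup>2"
  shows "ennreal ((\<integral>x. f x \<partial>\<nu>) - (\<integral>y. g y \<partial>\<mu>)) \<le> transport_cost 2 \<nu> \<mu>"
  unfolding transport_cost_def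
proof (rule INF_greatest)
  fix \<pi> assume \<pi>: "\<pi> \<in> couplings \<nu> \<mu>"
  interpret \<pi>: prob_space \<pi> using \<pi> assms(1) by (rule coupling_prob_space)
  have [measurable_cong]: "sets \<nu> = sets borel" "sets \<mu> = sets borel" by fact+
  have [measurable_cong]: "sets \<pi> = sets (borel \<Otimes>\<^sub>M borel)"
    using \<pi> by (auto simp: couplings_def assms(3,4) cong: sets_pair_measure_cong)
  have int: "integrable \<pi> (\<lambda>z. f (fst z))" "integrable \<pi> (\<lambda>z. g (snd z))"
    by (rule \<pi>.integrable_const_bound[where B = B]; use assms(7,8) in simp)+
  have "(\<integral>x. f x \<partial>\<nu>) - (\<integral>y. g y \<partial>\<mu>) = (\<integral>z. f (fst z) - g (snd z) \<partial>\<pi>)"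
    using int coupling_integral(1)[OF \<pi>, of f] coupling_integral(2)[OF \<pi>, of g] by simp
  also have "\<dots> \<le> (\<integral>z. max 0 (f (fst z) - g (snd z)) \<partial>\<pi>)"
    using int by (intro integral_mono) auto
  finally have "ennreal ((\<integral>x. f x \<partial>\<nu>) - (\<integral>y. g y \<partial>\<mu>))
      \<le> ennreal (\<integral>z. max 0 (f (fst z) - g (snd z)) \<partial>\<pi>)"
    by (rule ennreal_leI)
  also have "\<dots> = (\<integral>\<^sup>+z. ennreal (max 0 (f (fst z) - g (snd z))) \<partial>\<pi>)"
    using int by (intro nn_integral_eq_integral[symmetric]) auto
  also have "\<dots> \<le> (\<integral>\<^sup>+z. ennreal (dist (fst z) (snd z) powr 2) \<partial>\<pi>)"
  proof (intro nn_integral_mono ennreal_leI)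
    fix z
    show "max 0 (f (fst z) - g (snd z)) \<le> dist (fst z) (snd z) powr 2"
      using fg[of "fst z" "snd z"] by simp
  qed
  finally show "ennreal ((\<integral>x. f x \<partial>\<nu>) - (\<integral>y. g y \<partial>\<mu>))
      \<le> (\<integral>\<^sup>+z. ennreal (dist (fst z) (snd z) powr 2) \<partial>\<pi>)" .
qed

lemma transport_T2_dual:
  fixes \<mu> :: "'a::polish_space measure" and f g :: "'a \<Rightarrow> real"
  assumes T2: "transport_T2 \<alpha> \<mu>" and "\<alpha> > 0" and "prob_space \<mu>" and sets: "sets \<mu> = sets borel"
    and [measurable]: "f \<in> borel_measurable borel" "g \<in> borel_measurable borel"
    and fB: "\<And>x. \<bar>f x\<bar> \<le> B" and gB: "\<And>x. \<bar>g x\<bar> \<le> B"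
    and fg: "\<And>x y. f x \<le> g y + (dist x y)\<^sup>2"
  shows "(\<integral>x. exp (\<alpha> / 2 * f x) \<partial>\<mu>) \<le> exp (\<alpha> / 2 * (\<integral>x. g x \<partial>\<mu>))"
proof -
  interpret prob_space \<mu> by fact
  have [measurable_cong]: "sets \<mu> = sets borel" by fact
  define c where "c = \<alpha> / 2"
  have c: "c > 0" using \<open>\<alpha> > 0\<close> by (simp add: c_def)
  have cf: "\<bar>c * f x\<bar> \<le> c * B" for x
    using fB[of x] c by (simp add: abs_mult)
  have int: "integrable \<mu> (\<lambda>x. exp (c * f x))"
    by (rule integrable_const_bound[where B = "exp (c * B)"]) (use cf in \<open>auto simp: abs_le_iff\<close>)
  define Z where "Z = (\<integral>x. exp (c * f x) \<partial>\<mu>)"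
  have Z: "Z > 0"
  proof -
    have "(\<integral>x. exp (- (c * B)) \<partial>\<mu>) \<le> Z"
      unfolding Z_def using int cf by (intro integral_mono) (auto simp: abs_le_iff minus_le_iff)
    then have "exp (- (c * B)) \<le> Z" by (simp add: prob_space)
    then show ?thesis using exp_gt_zero[of "- (c * B)"] by (rule order_less_le_trans[rotated])
  qed
  \<comment> \<open>The density of the measure to which the transport inequality is applied.\<close>
  define h where "h = (\<lambda>x. exp (c * f x) / Z)"
  have [measurable]: "h \<in> borel_measurable \<mu>" unfolding h_def by simp
  have h0: "h x \<ge> 0" for x using Z by (simp add: h_def)
  have lnh: "ln (h x) = c * f x - ln Z" for x
    using Z by (simp add: h_def ln_div)
  have "emeasure (density \<mu> h) (space (density \<mu> h)) = (\<integral>\<^sup>+x. ennreal (h x) \<partial>\<mu>)"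
    by (auto simp: emeasure_density cong: nn_integral_cong)
  also have "\<dots> = ennreal (\<integral>x. h x \<partial>\<mu>)"
    using int h0 by (intro nn_integral_eq_integral) (auto simp: h_def)
  also have "(\<integral>x. h x \<partial>\<mu>) = 1"
    using Z by (simp add: h_def Z_def)
  finally have prob: "prob_space (density \<mu> h)" by (intro prob_spaceI) simp
  interpret N: prob_space "density \<mu> h" by fact
  have ln_le: "\<bar>ln (h x)\<bar> \<le> c * B + \<bar>ln Z\<bar>" for x
    using cf[of x] unfolding lnh by linarith
  have "ennreal ((\<integral>x. f x \<partial>density \<mu> h) - (\<integral>x. g x \<partial>\<mu>)) \<le> transport_cost 2 (density \<mu> h) \<mu>"
    by (rule coupling_gain_le_transport_cost[OF prob \<open>prob_space \<mu>\<close> _ sets _ _ fB gB fg]) (auto simp: sets)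
  also have "\<dots> \<le> ennreal ((\<integral>x. ln (h x) \<partial>density \<mu> h) / c)"
    using transport_T2_density[OF T2 \<open>prob_space \<mu>\<close> _ h0 prob ln_le] by (simp add: c_def field_simps)
  \<comment> \<open>The comparison passes from \<open>ennreal\<close> to \<open>real\<close> because the entropy is nonnegative.\<close>
  finally have "(\<integral>x. f x \<partial>density \<mu> h) - (\<integral>x. g x \<partial>\<mu>) \<le> (\<integral>x. ln (h x) \<partial>density \<mu> h) / c"
    using relative_entropy_density(3)[OF \<open>prob_space \<mu>\<close> _ h0 prob ln_le] c by (simp add: ennreal_le_iff)
  moreover have "integrable (density \<mu> h) f"
    by (rule N.integrable_const_bound[where B = B]) (use fB in auto)
  then have "(\<integral>x. ln (h x) \<partial>density \<mu> h) = c * (\<integral>x. f x \<partial>density \<mu> h) - ln Z"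
    unfolding lnh using N.prob_space by simp
  ultimately have "ln Z \<le> c * (\<integral>x. g x \<partial>\<mu>)"
    using c by (simp add: field_simps)
  then have "Z \<le> exp (c * (\<integral>x. g x \<partial>\<mu>))"
    using Z by (metis exp_le_cancel_iff exp_ln)
  then show ?thesis by (simp add: Z_def c_def)
qed

text \<open>
  Tensorization, by induction on the set of coordinates. For fixed \<open>x\<close> and \<open>y\<close> in the
  product over \<open>I\<close>, the one-dimensional inequality applies to the sections \<open>f(x, \<cdot>)\<close> and
  \<open>g(y, \<cdot>) + \<Sum> d(x\<^sub>j, y\<^sub>j)\<^sup>2\<close>. Its conclusion is the assumption of the induction hypothesis for the
  functions \<open>f'\<close> and \<open>g'\<close> on that product.
\<close>
lemma transport_T2_dual_PiM:
  fixes \<mu> :: "'a::polish_space measure" and f g :: "('i \<Rightarrow> 'a) \<Rightarrow> real"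
  assumes T2: "transport_T2 \<alpha> \<mu>" and \<alpha>: "\<alpha> > 0" and "prob_space \<mu>" and sets: "sets \<mu> = sets borel"
    and "finite I" and "f \<in> borel_measurable (\<Pi>\<^sub>M i\<in>I. \<mu>)" and "g \<in> borel_measurable (\<Pi>\<^sub>M i\<in>I. \<mu>)"
    and "\<And>x. x \<in> space (\<Pi>\<^sub>M i\<in>I. \<mu>) \<Longrightarrow> \<bar>f x\<bar> \<le> B"
    and "\<And>x. x \<in> space (\<Pi>\<^sub>M i\<in>I. \<mu>) \<Longrightarrow> \<bar>g x\<bar> \<le> B"
    and "\<And>x y. x \<in> space (\<Pi>\<^sub>M i\<in>I. \<mu>) \<Longrightarrow> y \<in> space (\<Pi>\<^sub>M i\<in>I. \<mu>) \<Longrightarrow>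
      f x \<le> g y + (\<Sum>i\<in>I. (dist (x i) (y i))\<^sup>2)"
  shows "(\<integral>x. exp (\<alpha> / 2 * f x) \<partial>(\<Pi>\<^sub>M i\<in>I. \<mu>)) \<le> exp (\<alpha> / 2 * (\<integral>x. g x \<partial>(\<Pi>\<^sub>M i\<in>I. \<mu>)))"
  using assms(5-)
proof (induction I arbitrary: f g rule: finite_induct)
  case empty
  interpret \<mu>: prob_space \<mu> by fact
  interpret product_prob_space "\<lambda>_. \<mu>" "{}" by standard
  let ?P = "\<Pi>\<^sub>M i\<in>{}::'i set. \<mu>"
  note [measurable] = empty(1,2)
  have int: "integrable ?P g"
    by (rule P.integrable_const_bound[where B = B]) (use empty(4) in \<open>auto intro!: AE_I2\<close>)
  have "f x \<le> (\<integral>y. g y \<partial>?P)" if "x \<in> space ?P" for x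
    using integral_mono[OF _ int, of "\<lambda>_. f x"] empty(5)[OF that] by (simp add: P.prob_space)
  then have *: "exp (\<alpha> / 2 * f x) \<le> exp (\<alpha> / 2 * (\<integral>y. g y \<partial>?P))" if "x \<in> space ?P" for x
    using \<alpha> that by simp
  have "integrable ?P (\<lambda>x. exp (\<alpha> / 2 * f x))"
    using * by (intro P.integrable_const_bound[where B = "exp (\<alpha> / 2 * (\<integral>y. g y \<partial>?P))"])
      (auto intro!: AE_I2)
  then show ?case
    using * by (intro P.integral_le_const) (auto intro!: AE_I2)
next
  case (insert i I)
  interpret \<mu>: prob_space \<mu> by fact
  interpret PI: product_prob_space "\<lambda>_. \<mu>" I by standard
  interpret PiI: product_prob_space "\<lambda>_. \<mu>" "insert i I" by standard
  interpret product_sigma_finite "\<lambda>_. \<mu>" by standard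
  have [measurable_cong]: "sets \<mu> = sets borel" by fact
  have sp[simp]: "space \<mu> = UNIV" using sets_eq_imp_space_eq[OF sets] by simp
  let ?S = "space (\<Pi>\<^sub>M i\<in>I. \<mu>)" and ?T = "space (\<Pi>\<^sub>M i\<in>insert i I. \<mu>)"
  define c where "c = \<alpha> / 2"
  have c: "c > 0" using \<alpha> by (simp add: c_def)
  note [measurable] = insert.prems(1,2)
  have upd_T: "x(i := a) \<in> ?T" if "x \<in> ?S" for x a
    using that by (auto simp: space_PiM PiE_def extensional_def)
  have upd[measurable]: "(\<lambda>a. x(i := a)) \<in> measurable borel (\<Pi>\<^sub>M i\<in>insert i I. \<mu>)" if "x \<in> ?S" for x
    using measurable_component_update[OF that insert.hyps(2)] by (simp add: measurable_cong_sets[OF sets])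
  have upd2[measurable]: "(\<lambda>(x, a). x(i := a)) \<in> measurable ((\<Pi>\<^sub>M i\<in>I. \<mu>) \<Otimes>\<^sub>M \<mu>) (\<Pi>\<^sub>M i\<in>insert i I. \<mu>)"
    by (rule measurable_add_dim)
  have fB: "\<bar>c * f z\<bar> \<le> c * B" if "z \<in> ?T" for z
    using insert.prems(3)[OF that] c by (simp add: abs_mult)
  define Z where "Z = (\<lambda>x. \<integral>a. exp (c * f (x(i := a))) \<partial>\<mu>)"
  define f' where "f' = (\<lambda>x. ln (Z x) / c)"
  define g' where "g' = (\<lambda>x. \<integral>a. g (x(i := a)) \<partial>\<mu>)"
  have Z_meas: "Z \<in> borel_measurable (\<Pi>\<^sub>M i\<in>I. \<mu>)"
    unfolding Z_def by measurable
  then have f'_meas: "f' \<in> borel_measurable (\<Pi>\<^sub>M i\<in>I. \<mu>)"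
    unfolding f'_def by measurable
  have g'_meas: "g' \<in> borel_measurable (\<Pi>\<^sub>M i\<in>I. \<mu>)"
    unfolding g'_def by measurable
  have intg: "integrable (\<Pi>\<^sub>M i\<in>insert i I. \<mu>) g"
    by (rule PiI.P.integrable_const_bound[where B = B]) (use insert.prems(4) in \<open>auto intro!: AE_I2\<close>)
  have intf: "integrable (\<Pi>\<^sub>M i\<in>insert i I. \<mu>) (\<lambda>x. exp (c * f x))"
    by (rule PiI.P.integrable_const_bound[where B = "exp (c * B)"])
      (use fB in \<open>auto intro!: AE_I2 simp: abs_le_iff\<close>)
  have Z_bounds: "exp (- (c * B)) \<le> Z x" "Z x \<le> exp (c * B)" if x: "x \<in> ?S" for x
  proof -
    have int: "integrable \<mu> (\<lambda>a. exp (c * f (x(i := a))))"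
      by (rule \<mu>.integrable_const_bound[where B = "exp (c * B)"])
        (use fB[OF upd_T[OF x]] x in \<open>auto simp: abs_le_iff\<close>)
    show "exp (- (c * B)) \<le> Z x" "Z x \<le> exp (c * B)"
      unfolding Z_def using fB[OF upd_T[OF x]] int
      by (auto intro!: \<mu>.integral_ge_const \<mu>.integral_le_const simp: abs_le_iff minus_le_iff)
  qed
  have Z_pos: "0 < Z x" if "x \<in> ?S" for x
    using Z_bounds(1)[OF that] exp_gt_zero by (rule order_less_le_trans[rotated])
  have exp_f': "exp (c * f' x) = Z x" if "x \<in> ?S" for x
    using Z_pos[OF that] c by (simp add: f'_def)
  have f'B: "\<bar>f' x\<bar> \<le> B" if "x \<in> ?S" for x
  proof -
    have "c * (- B) \<le> c * f' x" "c * f' x \<le> c * B"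
      using Z_bounds[OF that] by (simp_all flip: exp_f'[OF that])
    then show ?thesis using c by (simp only: mult_le_cancel_left_pos abs_le_iff) simp
  qed
  have g'B: "\<bar>g' x\<bar> \<le> B" if x: "x \<in> ?S" for x
  proof -
    have int: "integrable \<mu> (\<lambda>a. g (x(i := a)))"
      using insert.prems(4)[OF upd_T[OF x]] x
      by (intro \<mu>.integrable_const_bound[where B = B] AE_I2) (simp_all only: real_norm_def, measurable)
    have B: "- B \<le> g (x(i := a))" "g (x(i := a)) \<le> B" for a
      using insert.prems(4)[OF upd_T[OF x], of a] by (simp_all only: abs_le_iff) linarith
    have "- B \<le> g' x" "g' x \<le> B"
      unfolding g'_def
      using \<mu>.integral_ge_const[OF int AE_I2[OF B(1)]] \<mu>.integral_le_const[OF int AE_I2[OF B(2)]]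
      by simp_all
    then show ?thesis by simp
  qed
  have f'_le_g': "f' x \<le> g' y + (\<Sum>j\<in>I. (dist (x j) (y j))\<^sup>2)" if x: "x \<in> ?S" and y: "y \<in> ?S" for x y
  proof -
    define D where "D = (\<Sum>j\<in>I. (dist (x j) (y j))\<^sup>2)"
    have D0: "0 \<le> D" by (simp add: D_def sum_nonneg)
    have int: "integrable \<mu> (\<lambda>a. g (y(i := a)))"
      using insert.prems(4)[OF upd_T[OF y]] y
      by (intro \<mu>.integrable_const_bound[where B = B] AE_I2) (simp_all only: real_norm_def, measurable)
    have "Z x \<le> exp (c * (\<integral>b. g (y(i := b)) + D \<partial>\<mu>))"
      unfolding Z_def c_def
    proof (rule transport_T2_dual[OF T2 \<alpha> \<open>prob_space \<mu>\<close> sets, where B = "B + D"])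
      show "\<bar>f (x(i := a))\<bar> \<le> B + D" for a
        using insert.prems(3)[OF upd_T[OF x], of a] D0 by linarith
      show "\<bar>g (y(i := b)) + D\<bar> \<le> B + D" for b
        using insert.prems(4)[OF upd_T[OF y], of b] D0 by linarith
      show "f (x(i := a)) \<le> g (y(i := b)) + D + (dist a b)\<^sup>2" for a b
      proof -
        have "(\<Sum>j\<in>insert i I. (dist ((x(i := a)) j) ((y(i := b)) j))\<^sup>2) = (dist a b)\<^sup>2 + D"
          unfolding D_def using insert.hyps by (simp, intro sum.cong) auto
        then show ?thesis
          using insert.prems(5)[OF upd_T[OF x] upd_T[OF y], of a b] by linarith
      qed
    qed (use x y in measurable)
    also have "(\<integral>b. g (y(i := b)) + D \<partial>\<mu>) = g' y + D"
      using int by (simp add: g'_def \<mu>.prob_space[simplified])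
    finally show ?thesis
      using c unfolding exp_f'[OF x, symmetric] by (simp add: D_def)
  qed
  have "(\<integral>x. exp (c * f x) \<partial>(\<Pi>\<^sub>M i\<in>insert i I. \<mu>)) = (\<integral>x. Z x \<partial>(\<Pi>\<^sub>M i\<in>I. \<mu>))"
    unfolding Z_def by (rule product_integral_insert[OF insert.hyps intf])
  also have "\<dots> = (\<integral>x. exp (c * f' x) \<partial>(\<Pi>\<^sub>M i\<in>I. \<mu>))"
    by (rule Bochner_Integration.integral_cong) (simp_all add: exp_f')
  also have "\<dots> \<le> exp (c * (\<integral>x. g' x \<partial>(\<Pi>\<^sub>M i\<in>I. \<mu>)))"
    unfolding c_def by (rule insert.IH[OF f'_meas g'_meas f'B g'B f'_le_g'])
  also have "(\<integral>x. g' x \<partial>(\<Pi>\<^sub>M i\<in>I. \<mu>)) = (\<integral>x. g x \<partial>(\<Pi>\<^sub>M i\<in>insert i I. \<mu>))"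
    unfolding g'_def by (rule product_integral_insert[OF insert.hyps intg, symmetric])
  finally show ?case by (simp add: c_def)
qed

section \<open>Concentration of Lipschitz functions\<close>

lemma bounded_lipschitz_exp_moment:
  fixes \<mu> :: "'a::polish_space measure" and F :: "('i \<Rightarrow> 'a) \<Rightarrow> real"
  assumes T2: "transport_T2 \<alpha> \<mu>" and \<alpha>: "\<alpha> > 0" and "prob_space \<mu>" and sets: "sets \<mu> = sets borel"
    and "finite I" and [measurable]: "F \<in> borel_measurable (\<Pi>\<^sub>M i\<in>I. \<mu>)"
    and bound: "\<And>x. \<bar>F x\<bar> \<le> K" and "L \<ge> 0"
    and lip: "\<And>x y. \<bar>F x - F y\<bar> \<le> L * sqrt (\<Sum>i\<in>I. (dist (x i) (y i))\<^sup>2)"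
  shows "(\<integral>x. exp (t * F x) \<partial>(\<Pi>\<^sub>M i\<in>I. \<mu>))
    \<le> exp (t * (\<integral>x. F x \<partial>(\<Pi>\<^sub>M i\<in>I. \<mu>)) + t\<^sup>2 * L\<^sup>2 / (2 * \<alpha>))"
proof -
  let ?P = "\<Pi>\<^sub>M i\<in>I. \<mu>"
  \<comment> \<open>With this scaling, \<open>\<alpha> / 2\<close> times \<open>2 s F\<close> is \<open>t F\<close>.\<close>
  define s where "s = t / \<alpha>"
  have t: "t = \<alpha> * s" using \<alpha> by (simp add: s_def)
  define f where "f = (\<lambda>x. 2 * s * F x - s\<^sup>2 * L\<^sup>2)"
  define g where "g = (\<lambda>x. 2 * s * F x)"
  define B where "B = 2 * \<bar>s\<bar> * K + s\<^sup>2 * L\<^sup>2"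
  have gB: "\<bar>g x\<bar> \<le> 2 * \<bar>s\<bar> * K" for x
    using bound[of x] unfolding g_def by (simp add: abs_mult mult_left_mono)
  then have "\<bar>f x\<bar> \<le> B" "\<bar>g x\<bar> \<le> B" for x
  proof -
    have "0 \<le> s\<^sup>2 * L\<^sup>2" by simp
    moreover have "f x = g x - s\<^sup>2 * L\<^sup>2" by (simp add: f_def g_def)
    ultimately show "\<bar>f x\<bar> \<le> B" "\<bar>g x\<bar> \<le> B"
      using gB[of x] unfolding B_def by linarith+
  qed
  moreover have "f x \<le> g y + (\<Sum>i\<in>I. (dist (x i) (y i))\<^sup>2)" for x y
  proof -
    define D where "D = sqrt (\<Sum>i\<in>I. (dist (x i) (y i))\<^sup>2)"
    have "s * (F x - F y) \<le> \<bar>s\<bar> * \<bar>F x - F y\<bar>"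
      by (metis abs_ge_self abs_mult)
    also have "\<dots> \<le> \<bar>s\<bar> * (L * D)"
      using lip[of x y] by (intro mult_left_mono) (auto simp: D_def)
    finally have "2 * s * F x - 2 * s * F y \<le> 2 * ((\<bar>s\<bar> * L) * D)"
      by (simp add: algebra_simps)
    also have "\<dots> \<le> (\<bar>s\<bar> * L)\<^sup>2 + D\<^sup>2"
      using sum_squares_bound[of "\<bar>s\<bar> * L" D] by (simp add: mult.assoc)
    also have "D\<^sup>2 = (\<Sum>i\<in>I. (dist (x i) (y i))\<^sup>2)"
      by (simp add: D_def sum_nonneg)
    finally show ?thesis by (simp add: f_def g_def power_mult_distrib)
  qed
  ultimately have "(\<integral>x. exp (\<alpha> / 2 * f x) \<partial>?P) \<le> exp (\<alpha> / 2 * (\<integral>x. g x \<partial>?P))"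
    by (intro transport_T2_dual_PiM[OF T2 \<alpha> \<open>prob_space \<mu>\<close> sets \<open>finite I\<close>, where B = B])
      (auto simp: f_def g_def)
  also have "\<alpha> / 2 * (\<integral>x. g x \<partial>?P) = t * (\<integral>x. F x \<partial>?P)"
    by (simp add: g_def t)
  also have "(\<lambda>x. exp (\<alpha> / 2 * f x)) = (\<lambda>x. exp (t * F x) / exp (t\<^sup>2 * L\<^sup>2 / (2 * \<alpha>)))"
    using \<alpha> by (auto simp: f_def t field_simps power2_eq_square simp flip: exp_diff)
  finally show ?thesis
    by (simp add: exp_add field_simps)
qed

text \<open>
  Boundedness is removed by truncation and Fatou's lemma; the means of the truncated functions
  converge because \<open>F\<close> is integrable.
\<close>
lemma lipschitz_exp_moment:
  fixes \<mu> :: "'a::polish_space measure" and F :: "('i \<Rightarrow> 'a) \<Rightarrow> real"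
  assumes T2: "transport_T2 \<alpha> \<mu>" and \<alpha>: "\<alpha> > 0" and "prob_space \<mu>" and sets: "sets \<mu> = sets borel"
    and "finite I" and int: "integrable (\<Pi>\<^sub>M i\<in>I. \<mu>) F" and "L \<ge> 0"
    and lip: "\<And>x y. \<bar>F x - F y\<bar> \<le> L * sqrt (\<Sum>i\<in>I. (dist (x i) (y i))\<^sup>2)"
  shows "(\<integral>\<^sup>+x. ennreal (exp (t * F x)) \<partial>(\<Pi>\<^sub>M i\<in>I. \<mu>))
    \<le> ennreal (exp (t * (\<integral>x. F x \<partial>(\<Pi>\<^sub>M i\<in>I. \<mu>)) + t\<^sup>2 * L\<^sup>2 / (2 * \<alpha>)))"
proof -
  let ?P = "\<Pi>\<^sub>M i\<in>I. \<mu>"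
  interpret \<mu>: prob_space \<mu> by fact
  interpret product_prob_space "\<lambda>_. \<mu>" I by standard
  have [measurable]: "F \<in> borel_measurable ?P" using int by simp
  define G where "G = (\<lambda>(n::nat) x. max (- real n) (min (real n) (F x)))"
  have [measurable]: "G n \<in> borel_measurable ?P" for n unfolding G_def by simp
  have GF: "(\<lambda>n. G n x) \<longlonglongrightarrow> F x" for x
  proof (rule tendsto_eventually)
    show "eventually (\<lambda>n. G n x = F x) sequentially"
      using eventually_ge_at_top[of "nat \<lceil>\<bar>F x\<bar>\<rceil>"]
    proof eventually_elim
      case (elim n)
      then have "\<bar>F x\<bar> \<le> real n" by linarith
      then show ?case by (auto simp: G_def)
    qed
  qed
  have mean: "(\<lambda>n. \<integral>x. G n x \<partial>?P) \<longlonglongrightarrow> (\<integral>x. F x \<partial>?P)"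
    by (rule integral_dominated_convergence[where w = "\<lambda>x. \<bar>F x\<bar>"])
      (use int GF in \<open>auto simp: G_def\<close>)
  define b where "b = (\<lambda>m. ennreal (exp (t * m + t\<^sup>2 * L\<^sup>2 / (2 * \<alpha>))))"
  have "(\<integral>\<^sup>+x. ennreal (exp (t * F x)) \<partial>?P) = (\<integral>\<^sup>+x. liminf (\<lambda>n. ennreal (exp (t * G n x))) \<partial>?P)"
  proof (intro nn_integral_cong)
    fix x
    have "(\<lambda>n. ennreal (exp (t * G n x))) \<longlonglongrightarrow> ennreal (exp (t * F x))"
      by (intro tendsto_ennrealI tendsto_exp tendsto_mult tendsto_const GF)
    then show "ennreal (exp (t * F x)) = liminf (\<lambda>n. ennreal (exp (t * G n x)))"
      by (rule lim_imp_Liminf[OF sequentially_bot, symmetric])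
  qed
  also have "\<dots> \<le> liminf (\<lambda>n. \<integral>\<^sup>+x. ennreal (exp (t * G n x)) \<partial>?P)"
    by (rule nn_integral_liminf) measurable
  also have "\<dots> \<le> liminf (\<lambda>n. b (\<integral>x. G n x \<partial>?P))"
  proof (intro Liminf_mono always_eventually allI)
    fix n
    have bound: "\<bar>G n x\<bar> \<le> real n" for x by (auto simp: G_def)
    have "(\<integral>\<^sup>+x. ennreal (exp (t * G n x)) \<partial>?P) = ennreal (\<integral>x. exp (t * G n x) \<partial>?P)"
    proof (intro nn_integral_eq_integral P.integrable_const_bound[where B = "exp (\<bar>t\<bar> * n)"] AE_I2)
      fix x
      have "t * G n x \<le> \<bar>t\<bar> * \<bar>G n x\<bar>"
        by (metis abs_ge_self abs_mult)
      also have "\<dots> \<le> \<bar>t\<bar> * n" using bound by (intro mult_left_mono) auto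
      finally show "norm (exp (t * G n x)) \<le> exp (\<bar>t\<bar> * n)" by simp
    qed auto
    also have "\<dots> \<le> b (\<integral>x. G n x \<partial>?P)"
      unfolding b_def
    proof (intro ennreal_leI bounded_lipschitz_exp_moment[OF T2 \<alpha> \<open>prob_space \<mu>\<close> sets \<open>finite I\<close> _ bound \<open>L \<ge> 0\<close>])
      fix x y
      have "\<bar>G n x - G n y\<bar> \<le> \<bar>F x - F y\<bar>" unfolding G_def by linarith
      then show "\<bar>G n x - G n y\<bar> \<le> L * sqrt (\<Sum>i\<in>I. (dist (x i) (y i))\<^sup>2)"
        using lip[of x y] by linarith
    qed measurable
    finally show "(\<integral>\<^sup>+x. ennreal (exp (t * G n x)) \<partial>?P) \<le> b (\<integral>x. G n x \<partial>?P)" .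
  qed
  also have "(\<lambda>n. b (\<integral>x. G n x \<partial>?P)) \<longlonglongrightarrow> b (\<integral>x. F x \<partial>?P)"
    unfolding b_def by (intro tendsto_ennrealI tendsto_exp tendsto_add tendsto_mult tendsto_const mean)
  then have "liminf (\<lambda>n. b (\<integral>x. G n x \<partial>?P)) = b (\<integral>x. F x \<partial>?P)"
    by (rule lim_imp_Liminf[OF sequentially_bot])
  finally show ?thesis unfolding b_def .
qed

lemma lipschitz_upper_deviation:
  fixes \<mu> :: "'a::polish_space measure" and F :: "('i \<Rightarrow> 'a) \<Rightarrow> real"
  assumes T2: "transport_T2 \<alpha> \<mu>" and \<alpha>: "\<alpha> > 0" and "prob_space \<mu>" and sets: "sets \<mu> = sets borel"
    and "finite I" and int: "integrable (\<Pi>\<^sub>M i\<in>I. \<mu>) F" and L: "L > 0"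
    and lip: "\<And>x y. \<bar>F x - F y\<bar> \<le> L * sqrt (\<Sum>i\<in>I. (dist (x i) (y i))\<^sup>2)"
    and "\<epsilon> > 0"
  defines "P \<equiv> \<Pi>\<^sub>M i\<in>I. \<mu>"
  shows "measure P {x \<in> space P. F x - (\<integral>x. F x \<partial>P) \<ge> \<epsilon>} \<le> exp (- (\<alpha> * \<epsilon>\<^sup>2 / (2 * L\<^sup>2)))"
proof -
  interpret \<mu>: prob_space \<mu> by fact
  interpret product_prob_space "\<lambda>_. \<mu>" I by standard
  have [measurable]: "F \<in> borel_measurable P" using int by (simp add: P_def)
  define m where "m = (\<integral>x. F x \<partial>P)"
  \<comment> \<open>This \<open>t\<close> minimizes the exponent \<open>- t \<epsilon> + t\<^sup>2 L\<^sup>2 / (2 \<alpha>)\<close>.\<close>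
  define t where "t = \<alpha> * \<epsilon> / L\<^sup>2"
  have t: "t > 0" using \<alpha> L \<open>\<epsilon> > 0\<close> by (simp add: t_def)
  have "emeasure P {x \<in> space P. F x - m \<ge> \<epsilon>} = emeasure P {x \<in> space P. F x \<ge> m + \<epsilon>}"
    by (intro arg_cong[where f = "emeasure P"]) auto
  also have "\<dots> \<le> ennreal (exp (- t * (m + \<epsilon>))) *
      (\<integral>\<^sup>+x. ennreal (exp (t * F x)) * indicator (space P) x \<partial>P)"
    using t by (intro Chernoff_ineq_nn_integral_ge) auto
  also have "(\<integral>\<^sup>+x. ennreal (exp (t * F x)) * indicator (space P) x \<partial>P) = (\<integral>\<^sup>+x. ennreal (exp (t * F x)) \<partial>P)"
    by (intro nn_integral_cong) simp
  also have "ennreal (exp (- t * (m + \<epsilon>))) * \<dots>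
      \<le> ennreal (exp (- t * (m + \<epsilon>))) * ennreal (exp (t * m + t\<^sup>2 * L\<^sup>2 / (2 * \<alpha>)))"
    unfolding P_def m_def using L
    by (intro mult_left_mono lipschitz_exp_moment[OF T2 \<alpha> \<open>prob_space \<mu>\<close> sets \<open>finite I\<close> int _ lip]) auto
  also have "\<dots> = ennreal (exp (- t * \<epsilon> + t\<^sup>2 * L\<^sup>2 / (2 * \<alpha>)))"
    by (simp add: ennreal_mult[symmetric] exp_add[symmetric] algebra_simps)
  also have "- t * \<epsilon> + t\<^sup>2 * L\<^sup>2 / (2 * \<alpha>) = - (\<alpha> * \<epsilon>\<^sup>2 / (2 * L\<^sup>2))"
    using \<alpha> L by (simp add: t_def field_simps power2_eq_square)
  finally show ?thesis
    unfolding m_def[symmetric] by (simp add: measure_def enn2real_leI)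
qed

lemma lipschitz_concentration:
  fixes \<mu> :: "'a::polish_space measure" and F :: "('i \<Rightarrow> 'a) \<Rightarrow> real"
  assumes T2: "transport_T2 \<alpha> \<mu>" and \<alpha>: "\<alpha> > 0" and "prob_space \<mu>" and sets: "sets \<mu> = sets borel"
    and "finite I" and int: "integrable (\<Pi>\<^sub>M i\<in>I. \<mu>) F" and L: "L > 0"
    and lip: "\<And>x y. \<bar>F x - F y\<bar> \<le> L * sqrt (\<Sum>i\<in>I. (dist (x i) (y i))\<^sup>2)"
    and \<epsilon>: "\<epsilon> > 0"
  defines "P \<equiv> \<Pi>\<^sub>M i\<in>I. \<mu>"
  shows "measure P {x \<in> space P. \<bar>F x - (\<integral>x. F x \<partial>P)\<bar> > \<epsilon>} \<le> 2 * exp (- (\<alpha> * \<epsilon>\<^sup>2 / (2 * L\<^sup>2)))"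
proof -
  interpret \<mu>: prob_space \<mu> by fact
  interpret product_prob_space "\<lambda>_. \<mu>" I by standard
  have [measurable]: "F \<in> borel_measurable P" using int by (simp add: P_def)
  have fin: "finite_measure P" unfolding P_def by (rule P.finite_measure_axioms)
  define m where "m = (\<integral>x. F x \<partial>P)"
  define e where "e = exp (- (\<alpha> * \<epsilon>\<^sup>2 / (2 * L\<^sup>2)))"
  let ?U = "{x \<in> space P. F x - m \<ge> \<epsilon>}" and ?V = "{x \<in> space P. - F x - (\<integral>x. - F x \<partial>P) \<ge> \<epsilon>}"
  have "measure P {x \<in> space P. \<bar>F x - m\<bar> > \<epsilon>} \<le> measure P (?U \<union> ?V)"
    by (rule finite_measure.finite_measure_mono[OF fin]) (auto simp: m_def)
  also have "\<dots> \<le> measure P ?U + measure P ?V"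
    by (rule measure_Un_le) measurable
  also have "measure P ?U \<le> e"
    unfolding P_def m_def e_def
    by (rule lipschitz_upper_deviation[OF T2 \<alpha> \<open>prob_space \<mu>\<close> sets \<open>finite I\<close> int L lip \<epsilon>])
  also have "measure P ?V \<le> e"
    unfolding P_def e_def
    by (rule lipschitz_upper_deviation[OF T2 \<alpha> \<open>prob_space \<mu>\<close> sets \<open>finite I\<close> _ L _ \<epsilon>])
      (use int lip in \<open>auto simp: abs_minus_commute\<close>)
  finally show ?thesis by (simp add: m_def e_def)
qed

section \<open>Second moments\<close>

text \<open>
  The normalized restriction of \<open>\<mu>\<close> to a ball of positive measure has finite relative entropy, so
  some coupling transports it to \<open>\<mu>\<close> at finite quadratic cost.
\<close>
lemma transport_T2_second_moment:
  fixes \<mu> :: "'a::polish_space measure"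
  assumes T2: "transport_T2 \<alpha> \<mu>" and "prob_space \<mu>" and sets: "sets \<mu> = sets borel"
  shows "(\<integral>\<^sup>+y. ennreal ((dist x0 y)\<^sup>2) \<partial>\<mu>) < \<top>"
proof -
  interpret prob_space \<mu> by fact
  have [measurable_cong]: "sets \<mu> = sets borel" by fact
  have sp[simp]: "space \<mu> = UNIV" using sets_eq_imp_space_eq[OF sets] by simp
  have "\<exists>n::nat. emeasure \<mu> (ball x0 n) \<noteq> 0"
  proof (rule ccontr)
    assume "\<not> ?thesis"
    then have "emeasure \<mu> (\<Union>n::nat. ball x0 n) = 0"
      by (intro emeasure_UN_eq_0) (auto simp: sets)
    also have "(\<Union>n::nat. ball x0 n) = UNIV"
      using reals_Archimedean2 by auto
    finally show False using emeasure_space_1 by simp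
  qed
  then obtain R :: nat where R: "emeasure \<mu> (ball x0 R) \<noteq> 0" by blast
  define m where "m = prob (ball x0 R)"
  have m: "m > 0" using R by (simp add: m_def emeasure_eq_measure zero_less_measure_iff)
  define f where "f = (\<lambda>x. indicator (ball x0 R) x / m)"
  have [measurable]: "f \<in> borel_measurable \<mu>" unfolding f_def
    by (intro borel_measurable_divide borel_measurable_indicator borel_measurable_const) (simp add: sets)
  have f0: "0 \<le> f x" for x using m by (simp add: f_def)
  have "emeasure (density \<mu> f) (space (density \<mu> f)) = (\<integral>\<^sup>+x. ennreal (f x) \<partial>\<mu>)"
    by (subst emeasure_density) auto
  also have "\<dots> = (\<integral>\<^sup>+x. ennreal (1 / m) * indicator (ball x0 R) x \<partial>\<mu>)"
    by (intro nn_integral_cong) (simp add: f_def split: split_indicator)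
  also have "\<dots> = ennreal (1 / m) * ennreal m"
    by (subst nn_integral_cmult_indicator) (auto simp: m_def emeasure_eq_measure sets)
  also have "\<dots> = 1"
    using m by (simp flip: ennreal_mult)
  finally have prob: "prob_space (density \<mu> f)" by (rule prob_spaceI)
  have "\<bar>ln (f x)\<bar> \<le> \<bar>ln (1 / m)\<bar>" for x
    by (simp add: f_def split: split_indicator)
  from transport_T2_density[OF T2 \<open>prob_space \<mu>\<close> _ f0 prob this]
  have "transport_cost 2 (density \<mu> f) \<mu> < \<top>"
    by (auto simp: less_top[symmetric] top_unique)
  then obtain \<pi> where \<pi>: "\<pi> \<in> couplings (density \<mu> f) \<mu>"
    and cost: "(\<integral>\<^sup>+z. ennreal (dist (fst z) (snd z) powr 2) \<partial>\<pi>) < \<top>"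
    unfolding transport_cost_def INF_less_iff by blast
  have "sets (density \<mu> f \<Otimes>\<^sub>M \<mu>) = sets (borel \<Otimes>\<^sub>M borel)"
    by (rule sets_pair_measure_cong) (simp_all add: sets)
  then have [measurable_cong]: "sets \<pi> = sets (borel \<Otimes>\<^sub>M borel)"
    using \<pi> by (simp add: couplings_def)
  have "(\<integral>\<^sup>+z. ennreal ((dist x0 (fst z))\<^sup>2) \<partial>\<pi>) = (\<integral>\<^sup>+x. ennreal ((dist x0 x)\<^sup>2) \<partial>density \<mu> f)"
    by (rule coupling_nn_integral(1)[OF \<pi>]) simp
  also have "\<dots> = (\<integral>\<^sup>+x. f x * ennreal ((dist x0 x)\<^sup>2) \<partial>\<mu>)"
    by (rule nn_integral_density) auto
  also have "\<dots> \<le> (\<integral>\<^sup>+x. ennreal ((real R)\<^sup>2 / m) \<partial>\<mu>)"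
  proof (rule nn_integral_mono)
    fix x
    have "f x * (dist x0 x)\<^sup>2 \<le> (real R)\<^sup>2 / m"
    proof (cases "x \<in> ball x0 R")
      case True
      then have "(dist x0 x)\<^sup>2 \<le> (real R)\<^sup>2" by (intro power_mono) auto
      then show ?thesis using True m by (simp add: f_def divide_right_mono)
    qed (use m in \<open>simp add: f_def\<close>)
    then show "f x * ennreal ((dist x0 x)\<^sup>2) \<le> ennreal ((real R)\<^sup>2 / m)"
      using f0[of x] by (simp flip: ennreal_mult add: ennreal_leI)
  qed
  also have "\<dots> = ennreal ((real R)\<^sup>2 / m)"
    using emeasure_space_1 by simp
  finally have *: "(\<integral>\<^sup>+z. ennreal ((dist x0 (fst z))\<^sup>2) \<partial>\<pi>) < \<top>"
    by (rule le_less_trans) simp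
  have "(\<integral>\<^sup>+y. ennreal ((dist x0 y)\<^sup>2) \<partial>\<mu>) = (\<integral>\<^sup>+z. ennreal ((dist x0 (snd z))\<^sup>2) \<partial>\<pi>)"
    by (rule coupling_nn_integral(2)[OF \<pi>, symmetric]) simp
  also have "\<dots> \<le> (\<integral>\<^sup>+z. 2 * ennreal ((dist x0 (fst z))\<^sup>2) + 2 * ennreal (dist (fst z) (snd z) powr 2) \<partial>\<pi>)"
  proof (rule nn_integral_mono)
    fix z
    have "(dist x0 (snd z))\<^sup>2 \<le> (dist x0 (fst z) + dist (fst z) (snd z))\<^sup>2"
      by (intro power_mono dist_triangle) simp
    also have "\<dots> \<le> 2 * (dist x0 (fst z))\<^sup>2 + 2 * (dist (fst z) (snd z))\<^sup>2"
      using sum_squares_bound[of "dist x0 (fst z)" "dist (fst z) (snd z)"]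
      by (simp add: power2_sum)
    finally have "ennreal ((dist x0 (snd z))\<^sup>2)
        \<le> ennreal (2 * (dist x0 (fst z))\<^sup>2 + 2 * (dist (fst z) (snd z))\<^sup>2)"
      by (rule ennreal_leI)
    then show "ennreal ((dist x0 (snd z))\<^sup>2)
        \<le> 2 * ennreal ((dist x0 (fst z))\<^sup>2) + 2 * ennreal (dist (fst z) (snd z) powr 2)"
      by (simp add: ennreal_plus ennreal_mult)
  qed
  also have "\<dots> = 2 * (\<integral>\<^sup>+z. ennreal ((dist x0 (fst z))\<^sup>2) \<partial>\<pi>)
      + 2 * (\<integral>\<^sup>+z. ennreal (dist (fst z) (snd z) powr 2) \<partial>\<pi>)"
    by (simp add: nn_integral_add nn_integral_cmult)
  also have "\<dots> < \<top>"
    using cost * by (simp add: ennreal_mult_less_top)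
  finally show ?thesis .
qed

section \<open>Couplings with an empirical measure\<close>

lemma coupling_distr_fst:
  assumes \<sigma>: "\<sigma> \<in> couplings \<nu> \<mu>" and \<xi>[measurable]: "\<xi> \<in> measurable \<nu> M"
  shows "distr \<sigma> (distr \<nu> M \<xi> \<Otimes>\<^sub>M \<mu>) (map_prod \<xi> id) \<in> couplings (distr \<nu> M \<xi>) \<mu>"
proof -
  have [measurable_cong]: "sets \<sigma> = sets (\<nu> \<Otimes>\<^sub>M \<mu>)" and d: "distr \<sigma> \<nu> fst = \<nu>" "distr \<sigma> \<mu> snd = \<mu>"
    using \<sigma> by (auto simp: couplings_def)
  have [measurable]: "map_prod \<xi> id \<in> measurable \<sigma> (distr \<nu> M \<xi> \<Otimes>\<^sub>M \<mu>)"
    unfolding map_prod_def id_def by measurable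
  have "distr (distr \<sigma> (distr \<nu> M \<xi> \<Otimes>\<^sub>M \<mu>) (map_prod \<xi> id)) (distr \<nu> M \<xi>) fst
      = distr \<sigma> (distr \<nu> M \<xi>) (\<xi> \<circ> fst)"
    by (subst distr_distr) (auto simp: comp_def)
  also have "\<dots> = distr \<sigma> M (\<xi> \<circ> fst)"
    by (rule distr_cong) auto
  also have "\<dots> = distr (distr \<sigma> \<nu> fst) M \<xi>"
    by (rule distr_distr[symmetric]) auto
  also have "\<dots> = distr \<nu> M \<xi>" by (simp add: d)
  finally have 1: "distr (distr \<sigma> (distr \<nu> M \<xi> \<Otimes>\<^sub>M \<mu>) (map_prod \<xi> id)) (distr \<nu> M \<xi>) fst = distr \<nu> M \<xi>" .
  have "distr (distr \<sigma> (distr \<nu> M \<xi> \<Otimes>\<^sub>M \<mu>) (map_prod \<xi> id)) \<mu> snd = distr \<sigma> \<mu> snd"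
    by (subst distr_distr) (auto simp: comp_def)
  with 1 d show ?thesis by (simp add: couplings_def)
qed

text \<open>
  Every coupling of an image law \<open>L\<close> of \<open>q\<close> under \<open>\<eta>\<close> with \<open>\<mu>\<close> comes from a coupling of \<open>q\<close> itself
  with \<open>\<mu>\<close>. The lift is obtained by disintegrating \<open>q\<close> along \<open>\<eta>\<close>: given \<open>\<eta> j = x\<close>, the index
  \<open>j\<close> has density \<open>1 / L {x}\<close> with respect to \<open>q\<close> on the fibre over \<open>x\<close>. This also covers points \<open>\<eta> j\<close> that coincide.
\<close>
lemma coupling_lift_fst:
  fixes q :: "'i::countable pmf" and \<eta> :: "'i \<Rightarrow> 'a::polish_space" and \<mu> :: "'b measure"
  assumes \<pi>: "\<pi> \<in> couplings (distr (measure_pmf q) borel \<eta>) \<mu>"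
  shows "\<exists>\<sigma>\<in>couplings (measure_pmf q) \<mu>. distr \<sigma> \<pi> (map_prod \<eta> id) = \<pi>"
proof -
  let ?U = "measure_pmf q"
  define L where "L = distr ?U borel \<eta>"
  have [measurable_cong]: "sets L = sets borel" by (simp add: L_def)
  have "sets \<pi> = sets (L \<Otimes>\<^sub>M \<mu>)" using \<pi> by (auto simp: couplings_def L_def)
  also have "\<dots> = sets (borel \<Otimes>\<^sub>M \<mu>)" by (rule sets_pair_measure_cong) (auto simp: L_def)
  finally have [measurable_cong]: "sets \<pi> = sets (borel \<Otimes>\<^sub>M \<mu>)" .
  have d: "distr \<pi> L fst = L" "distr \<pi> \<mu> snd = \<mu>"
    using \<pi> by (auto simp: couplings_def L_def)
  interpret L: prob_space L
    unfolding L_def by (rule measure_pmf.prob_space_distr) simp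
  interpret \<pi>: prob_space \<pi>
    using \<pi>[folded L_def] L.prob_space_axioms by (rule coupling_prob_space)
  interpret pair_sigma_finite ?U \<pi> by standard
  have L_pos: "emeasure L {\<eta> j} \<noteq> 0" if "j \<in> set_pmf q" for j
  proof -
    have "0 < emeasure ?U {j}"
      using that by (simp add: emeasure_pmf_single pmf_positive)
    also have "\<dots> \<le> emeasure ?U (\<eta> -` {\<eta> j})"
      by (rule emeasure_mono) auto
    finally show ?thesis by (simp add: L_def emeasure_distr)
  qed
  define k where "k = (\<lambda>(j, z :: 'a \<times> 'b). indicator {\<eta> j} (fst z) / emeasure L {\<eta> j})"
  have k_meas[measurable]: "k \<in> borel_measurable (?U \<Otimes>\<^sub>M \<pi>)"
  proof -
    have "k \<in> borel_measurable (count_space UNIV \<Otimes>\<^sub>M \<pi>)"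
      by (rule measurable_pair_measure_countable1) (auto simp: k_def)
    then show ?thesis
      by (simp cong: measurable_cong_sets sets_pair_measure_cong)
  qed
  define \<sigma> where "\<sigma> = distr (density (?U \<Otimes>\<^sub>M \<pi>) k) (?U \<Otimes>\<^sub>M \<mu>) (\<lambda>(j, z). (j, snd z))"
  have [measurable_cong]: "sets \<sigma> = sets (?U \<Otimes>\<^sub>M \<mu>)" by (simp add: \<sigma>_def)
  have int_\<sigma>: "(\<integral>\<^sup>+s. h s \<partial>\<sigma>) = (\<integral>\<^sup>+j. \<integral>\<^sup>+z. k (j, z) * h (j, snd z) \<partial>\<pi> \<partial>?U)"
    if [measurable]: "h \<in> borel_measurable (?U \<Otimes>\<^sub>M \<mu>)" for h
  proof -
    have "(\<integral>\<^sup>+s. h s \<partial>\<sigma>) = (\<integral>\<^sup>+s. k s * h (fst s, snd (snd s)) \<partial>(?U \<Otimes>\<^sub>M \<pi>))"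
      by (simp add: \<sigma>_def nn_integral_distr nn_integral_density case_prod_beta)
    also have "\<dots> = (\<integral>\<^sup>+j. \<integral>\<^sup>+z. k (j, z) * h (j, snd z) \<partial>\<pi> \<partial>?U)"
      by (subst \<pi>.nn_integral_fst[symmetric]) auto
    finally show ?thesis .
  qed
  have push: "distr \<sigma> \<pi> (map_prod \<eta> id) = \<pi>"
  proof (rule measure_eqI)
    fix A assume "A \<in> sets (distr \<sigma> \<pi> (map_prod \<eta> id))"
    then have A[measurable]: "A \<in> sets \<pi>" by simp
    have [measurable]: "map_prod \<eta> id \<in> measurable \<sigma> \<pi>"
      unfolding map_prod_def id_def by measurable
    have "emeasure (distr \<sigma> \<pi> (map_prod \<eta> id)) A = (\<integral>\<^sup>+z. indicator A z \<partial>distr \<sigma> \<pi> (map_prod \<eta> id))"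
      by simp
    also have "\<dots> = (\<integral>\<^sup>+s. indicator A (\<eta> (fst s), snd s) \<partial>\<sigma>)"
      by (subst nn_integral_distr) (auto simp: map_prod_def case_prod_beta)
    also have "\<dots> = (\<integral>\<^sup>+j. \<integral>\<^sup>+z. k (j, z) * indicator A (\<eta> j, snd z) \<partial>\<pi> \<partial>?U)"
      by (subst int_\<sigma>) auto
    also have "\<dots> = (\<integral>\<^sup>+j. \<integral>\<^sup>+z. k (j, z) * indicator A z \<partial>\<pi> \<partial>?U)"
      by (intro nn_integral_cong) (auto simp: k_def split: split_indicator)
    also have "\<dots> = (\<integral>\<^sup>+z. \<integral>\<^sup>+j. k (j, z) * indicator A z \<partial>?U \<partial>\<pi>)"
      by (rule Fubini'[symmetric]) measurable
    also have "\<dots> = (\<integral>\<^sup>+z. indicator A z \<partial>\<pi>)"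
    proof (rule nn_integral_cong_AE)
      have "\<eta> ` set_pmf q \<in> sets borel"
        by (rule sets.countable) auto
      \<comment> \<open>Only on the support of \<open>L\<close> does \<open>1 / L {x}\<close> normalize the kernel.\<close>
      then have "AE x in L. x \<in> \<eta> ` set_pmf q"
        unfolding L_def by (subst AE_distr_iff) (auto simp: AE_measure_pmf_iff)
      then have "AE x in distr \<pi> L fst. x \<in> \<eta> ` set_pmf q" by (simp only: d)
      then have "AE z in \<pi>. fst z \<in> \<eta> ` set_pmf q"
        by (rule AE_distrD[rotated]) simp
      then show "AE z in \<pi>. (\<integral>\<^sup>+j. k (j, z) * indicator A z \<partial>?U) = indicator A z"
      proof eventually_elim
        case (elim z)
        define x where "x = fst z"
        have "(\<integral>\<^sup>+j. k (j, z) * indicator A z \<partial>?U) = (\<integral>\<^sup>+j. k (j, z) \<partial>?U) * indicator A z"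
          by (rule nn_integral_multc) simp
        also have "(\<integral>\<^sup>+j. k (j, z) \<partial>?U) = (\<integral>\<^sup>+j. indicator {x} (\<eta> j) / emeasure L {x} \<partial>?U)"
          by (intro nn_integral_cong) (auto simp: k_def x_def split: split_indicator)
        also have "\<dots> = (\<integral>\<^sup>+y. indicator {x} y / emeasure L {x} \<partial>L)"
          by (simp add: L_def nn_integral_distr)
        also have "\<dots> = emeasure L {x} / emeasure L {x}"
          by (subst nn_integral_divide) auto
        also have "\<dots> = 1"
          using elim L_pos by (auto simp: x_def L.emeasure_eq_measure intro!: ennreal_divide_self)
        finally show ?case by simp
      qed
    qed
    finally show "emeasure (distr \<sigma> \<pi> (map_prod \<eta> id)) A = emeasure \<pi> A" by simp
  qed simp
  have "distr \<sigma> ?U fst = ?U"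
  proof (rule measure_eqI)
    fix A assume "A \<in> sets (distr \<sigma> ?U fst)"
    have "emeasure (distr \<sigma> ?U fst) A = (\<integral>\<^sup>+z. indicator A z \<partial>distr \<sigma> ?U fst)"
      by simp
    also have "\<dots> = (\<integral>\<^sup>+s. indicator A (fst s) \<partial>\<sigma>)"
      by (rule nn_integral_distr) auto
    also have "\<dots> = (\<integral>\<^sup>+j. \<integral>\<^sup>+z. k (j, z) * indicator A j \<partial>\<pi> \<partial>?U)"
      by (subst int_\<sigma>) auto
    also have "\<dots> = (\<integral>\<^sup>+j. indicator A j \<partial>?U)"
    proof (rule nn_integral_cong_AE, subst AE_measure_pmf_iff, intro ballI)
      fix j assume j: "j \<in> set_pmf q"
      have "(\<integral>\<^sup>+z. k (j, z) * indicator A j \<partial>\<pi>) = (\<integral>\<^sup>+z. k (j, z) \<partial>\<pi>) * indicator A j"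
        by (rule nn_integral_multc) simp
      also have "(\<integral>\<^sup>+z. k (j, z) \<partial>\<pi>) = (\<integral>\<^sup>+x. indicator {\<eta> j} x / emeasure L {\<eta> j} \<partial>distr \<pi> L fst)"
        by (simp add: k_def nn_integral_distr)
      also have "\<dots> = emeasure L {\<eta> j} / emeasure L {\<eta> j}"
        unfolding d by (subst nn_integral_divide) auto
      also have "\<dots> = 1"
        using L_pos[OF j] by (auto simp: L.emeasure_eq_measure intro!: ennreal_divide_self)
      finally show "(\<integral>\<^sup>+z. k (j, z) * indicator A j \<partial>\<pi>) = indicator A j" by simp
    qed
    finally show "emeasure (distr \<sigma> ?U fst) A = emeasure ?U A" by simp
  qed simp
  moreover have "distr \<sigma> \<mu> snd = \<mu>"
  proof -
    have [measurable]: "map_prod \<eta> id \<in> measurable \<sigma> \<pi>"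
      unfolding map_prod_def id_def by measurable
    have "distr \<sigma> \<mu> snd = distr (distr \<sigma> \<pi> (map_prod \<eta> id)) \<mu> snd"
      by (subst distr_distr) (auto simp: comp_def)
    then show ?thesis by (simp add: push d)
  qed
  ultimately have "\<sigma> \<in> couplings ?U \<mu>" by (simp add: couplings_def \<sigma>_def)
  with push show ?thesis by blast
qed

lemma empirical_eq_distr:
  assumes "N \<ge> 1"
  shows "empirical N \<xi> = distr (measure_pmf (pmf_of_set {1..N})) borel \<xi>"
proof (rule measure_eqI)
  show "sets (empirical N \<xi>) = sets (distr (measure_pmf (pmf_of_set {1..N})) borel \<xi>)"
    using sets.sigma_sets_eq[of "borel :: 'a measure"] by (simp add: empirical_def)
  fix A assume "A \<in> sets (empirical N \<xi>)"
  then have A[measurable]: "A \<in> sets borel"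
    using sets.sigma_sets_eq[of "borel :: 'a measure"] by (simp add: empirical_def)
  have "emeasure (distr (measure_pmf (pmf_of_set {1..N})) borel \<xi>) A
      = (\<integral>\<^sup>+x. indicator A x \<partial>distr (measure_pmf (pmf_of_set {1..N})) borel \<xi>)"
    by simp
  also have "\<dots> = (\<integral>\<^sup>+j. indicator A (\<xi> j) \<partial>measure_pmf (pmf_of_set {1..N}))"
    by (rule nn_integral_distr) auto
  also have "\<dots> = (\<Sum>j=1..N. indicator A (\<xi> j)) / of_nat N"
    using assms by (subst nn_integral_pmf_of_set) (auto simp: ennreal_of_nat_eq_real_of_nat)
  finally show "emeasure (empirical N \<xi>) A = emeasure (distr (measure_pmf (pmf_of_set {1..N})) borel \<xi>) A"
    by (simp add: emeasure_empirical)
qed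

lemma transport_cost_empirical:
  fixes \<mu> :: "'a::polish_space measure"
  assumes "N \<ge> 1" and sets: "sets \<mu> = sets borel"
  shows "transport_cost p (empirical N \<xi>) \<mu>
    = (INF \<sigma>\<in>couplings (measure_pmf (pmf_of_set {1..N})) \<mu>.
        \<integral>\<^sup>+z. ennreal (dist (\<xi> (fst z)) (snd z) powr p) \<partial>\<sigma>)"
proof -
  let ?U = "measure_pmf (pmf_of_set {1..N})"
  have [measurable_cong]: "sets \<mu> = sets borel" by fact
  have "sets (distr ?U borel \<xi> \<Otimes>\<^sub>M \<mu>) = sets (borel \<Otimes>\<^sub>M borel)"
    by (rule sets_pair_measure_cong) (simp_all add: sets)
  note sets_D[measurable_cong] = this
  have int: "(\<integral>\<^sup>+z. ennreal (dist (fst z) (snd z) powr p) \<partial>distr \<sigma> M (map_prod \<xi> id))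
      = (\<integral>\<^sup>+z. ennreal (dist (\<xi> (fst z)) (snd z) powr p) \<partial>\<sigma>)"
    if \<sigma>: "\<sigma> \<in> couplings ?U \<mu>" and [measurable_cong]: "sets M = sets (borel \<Otimes>\<^sub>M borel)" for \<sigma> M
  proof -
    have [measurable_cong]: "sets \<sigma> = sets (?U \<Otimes>\<^sub>M \<mu>)" using \<sigma> by (rule sets_coupling)
    have [measurable]: "map_prod \<xi> id \<in> measurable \<sigma> M"
      unfolding map_prod_def id_def by measurable
    show ?thesis by (subst nn_integral_distr) (auto simp: map_prod_def case_prod_beta)
  qed
  show ?thesis
    unfolding transport_cost_def empirical_eq_distr[OF \<open>N \<ge> 1\<close>]
  proof (rule INF_eq)
    fix \<pi> assume \<pi>: "\<pi> \<in> couplings (distr ?U borel \<xi>) \<mu>"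
    then obtain \<sigma> where \<sigma>: "\<sigma> \<in> couplings ?U \<mu>" "distr \<sigma> \<pi> (map_prod \<xi> id) = \<pi>"
      using coupling_lift_fst by blast
    have "sets \<pi> = sets (borel \<Otimes>\<^sub>M borel)" using \<pi> sets_D by (simp add: couplings_def)
    from int[OF \<sigma>(1) this] \<sigma>
    show "\<exists>\<sigma>\<in>couplings ?U \<mu>. (\<integral>\<^sup>+z. ennreal (dist (\<xi> (fst z)) (snd z) powr p) \<partial>\<sigma>)
        \<le> (\<integral>\<^sup>+z. ennreal (dist (fst z) (snd z) powr p) \<partial>\<pi>)"
      by (intro bexI[of _ \<sigma>]) simp_all
  next
    fix \<sigma> assume \<sigma>: "\<sigma> \<in> couplings ?U \<mu>"
    let ?\<pi> = "distr \<sigma> (distr ?U borel \<xi> \<Otimes>\<^sub>M \<mu>) (map_prod \<xi> id)"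
    have "?\<pi> \<in> couplings (distr ?U borel \<xi>) \<mu>"
      by (rule coupling_distr_fst[OF \<sigma>]) simp
    with int[OF \<sigma> sets_D]
    show "\<exists>\<pi>\<in>couplings (distr ?U borel \<xi>) \<mu>. (\<integral>\<^sup>+z. ennreal (dist (fst z) (snd z) powr p) \<partial>\<pi>)
        \<le> (\<integral>\<^sup>+z. ennreal (dist (\<xi> (fst z)) (snd z) powr p) \<partial>\<sigma>)"
      by (intro bexI[of _ ?\<pi>]) simp_all
  qed
qed

section \<open>Lipschitz continuity of the empirical Wasserstein distance\<close>

text \<open>
  A weighted form of the \<open>p\<close>-th power of the triangle inequality. The right-hand side is affine in
  \<open>e\<^sup>2\<close> and in \<open>v\<^sup>p\<close>, so that it can be integrated term by term, and it is sharp at \<open>e = a\<close>,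
  \<open>v = r\<close>; together these two properties replace Minkowski's inequality. For \<open>p = 1\<close> it also
  contains the comparison of the mean of \<open>e\<close> with its quadratic mean.
\<close>
lemma powr_triangle_bound:
  fixes a r p :: real
  assumes "p \<in> {1, 2}" and "a > 0" and "r > 0"
  shows "\<exists>A B C. A \<ge> 0 \<and> B \<ge> 0 \<and> C \<ge> 0 \<and> A + B * a\<^sup>2 + C * r powr p = (a + r) powr p \<and>
    (\<forall>u v e. 0 \<le> u \<longrightarrow> 0 \<le> v \<longrightarrow> 0 \<le> e \<longrightarrow> u \<le> e + v \<longrightarrow> u powr p \<le> A + B * e\<^sup>2 + C * v powr p)"
proof (cases "p = 1")
  case True
  have bound: "u \<le> a / 2 + 1 / (2 * a) * e\<^sup>2 + 1 * v" if "u \<le> e + v" for u v e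
  proof -
    have "2 * a * e \<le> a\<^sup>2 + e\<^sup>2" by (rule sum_squares_bound)
    then have "e \<le> a / 2 + 1 / (2 * a) * e\<^sup>2" using \<open>a > 0\<close> by (simp add: field_simps power2_eq_square)
    with that show ?thesis by linarith
  qed
  have "a / 2 + 1 / (2 * a) * a\<^sup>2 + 1 * r = a + r"
    using assms by (simp add: power2_eq_square)
  then show ?thesis
    using True assms bound
    by (intro exI[of _ "a / 2"] exI[of _ "1 / (2 * a)"] exI[of _ 1] conjI allI impI) auto
next
  case False
  then have p: "p = 2" using assms by auto
  have bound: "u\<^sup>2 \<le> (1 + r / a) * e\<^sup>2 + (1 + a / r) * v\<^sup>2" if "0 \<le> u" "u \<le> e + v" for u v e
  proof -
    have "u\<^sup>2 \<le> (e + v)\<^sup>2" using that by (intro power_mono)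
    also have "\<dots> \<le> (1 + r / a) * e\<^sup>2 + (1 + a / r) * v\<^sup>2"
    proof -
      have "0 \<le> (r * e - a * v)\<^sup>2 / (a * r)" using assms by simp
      also have "(r * e - a * v)\<^sup>2 / (a * r) = (1 + r / a) * e\<^sup>2 + (1 + a / r) * v\<^sup>2 - (e + v)\<^sup>2"
        using assms by (simp add: field_simps power2_eq_square)
      finally show ?thesis by simp
    qed
    finally show ?thesis .
  qed
  have "0 + (1 + r / a) * a\<^sup>2 + (1 + a / r) * r\<^sup>2 = (a + r)\<^sup>2"
    using assms by (simp add: field_simps power2_eq_square)
  then show ?thesis
    using p assms bound
    by (intro exI[of _ 0] exI[of _ "1 + r / a"] exI[of _ "1 + a / r"] conjI allI impI) auto
qed

lemma transport_cost_empirical_finite: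
  fixes \<mu> :: "'a::polish_space measure"
  assumes T2: "transport_T2 \<alpha> \<mu>" and "prob_space \<mu>" and sets: "sets \<mu> = sets borel"
    and N: "N \<ge> 1" and p: "p \<in> {1, 2}"
  shows "transport_cost p (empirical N \<xi>) \<mu> < \<top>"
proof -
  interpret prob_space \<mu> by fact
  have [measurable_cong]: "sets \<mu> = sets borel" by fact
  let ?U = "measure_pmf (pmf_of_set {1..N})"
  have fst: "distr (?U \<Otimes>\<^sub>M \<mu>) ?U fst = ?U"
    by (rule distr_pair_fst)
  have snd: "distr (?U \<Otimes>\<^sub>M \<mu>) \<mu> snd = \<mu>"
  proof (rule measure_eqI)
    fix A assume "A \<in> sets (distr (?U \<Otimes>\<^sub>M \<mu>) \<mu> snd)"
    then have A: "A \<in> sets \<mu>" by simp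
    have "snd -` A \<inter> space (?U \<Otimes>\<^sub>M \<mu>) = space ?U \<times> A"
      using sets.sets_into_space[OF A] by (auto simp: space_pair_measure)
    then show "emeasure (distr (?U \<Otimes>\<^sub>M \<mu>) \<mu> snd) A = emeasure \<mu> A"
      using A by (simp add: emeasure_distr emeasure_pair_measure_Times)
  qed simp
  have fin: "(\<integral>\<^sup>+y. ennreal (dist x y powr p) \<partial>\<mu>) < \<top>" for x
  proof -
    have "(\<integral>\<^sup>+y. ennreal (dist x y powr p) \<partial>\<mu>) \<le> (\<integral>\<^sup>+y. 1 + ennreal ((dist x y)\<^sup>2) \<partial>\<mu>)"
    proof (rule nn_integral_mono)
      fix y
      have "dist x y powr p \<le> 1 + (dist x y)\<^sup>2"
        using p sum_squares_bound[of 1 "dist x y"] zero_le_dist[of x y] by (auto simp del: zero_le_dist)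
      then have "ennreal (dist x y powr p) \<le> ennreal (1 + (dist x y)\<^sup>2)" by (rule ennreal_leI)
      then show "ennreal (dist x y powr p) \<le> 1 + ennreal ((dist x y)\<^sup>2)" by (simp add: ennreal_plus)
    qed
    also have "\<dots> = 1 + (\<integral>\<^sup>+y. ennreal ((dist x y)\<^sup>2) \<partial>\<mu>)"
      by (simp add: nn_integral_add emeasure_space_1)
    also have "\<dots> < \<top>"
      using transport_T2_second_moment[OF T2 \<open>prob_space \<mu>\<close> sets, of x] by simp
    finally show ?thesis .
  qed
  have "transport_cost p (empirical N \<xi>) \<mu>
      \<le> (\<integral>\<^sup>+z. ennreal (dist (\<xi> (fst z)) (snd z) powr p) \<partial>(?U \<Otimes>\<^sub>M \<mu>))"
    unfolding transport_cost_empirical[OF N sets]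
    by (rule INF_lower) (simp only: couplings_def mem_Collect_eq fst snd simp_thms)
  also have "\<dots> = (\<integral>\<^sup>+j. \<integral>\<^sup>+y. ennreal (dist (\<xi> j) y powr p) \<partial>\<mu> \<partial>?U)"
    by (subst nn_integral_fst[symmetric]) auto
  also have "\<dots> = (\<Sum>j=1..N. \<integral>\<^sup>+y. ennreal (dist (\<xi> j) y powr p) \<partial>\<mu>) / of_nat N"
    using N by (subst nn_integral_pmf_of_set) (auto simp: ennreal_of_nat_eq_real_of_nat)
  also have "\<dots> < \<top>"
    using fin N by (simp add: less_top[symmetric] ennreal_divide_eq_top_iff)
  finally show ?thesis .
qed

lemma wasserstein_empirical_le:
  fixes \<mu> :: "'a::polish_space measure" and \<xi> \<eta> :: "nat \<Rightarrow> 'a"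
  assumes T2: "transport_T2 \<alpha> \<mu>" and "prob_space \<mu>" and sets: "sets \<mu> = sets borel"
    and N: "N \<ge> 1" and p: "p \<in> {1, 2}"
  shows "enn2real (wasserstein p (empirical N \<xi>) \<mu>) \<le> enn2real (wasserstein p (empirical N \<eta>) \<mu>)
    + 1 / sqrt N * sqrt (\<Sum>j=1..N. (dist (\<xi> j) (\<eta> j))\<^sup>2)"
proof -
  let ?U = "measure_pmf (pmf_of_set {1..N})"
  define c where "c = (\<lambda>\<xi>. transport_cost p (empirical N \<xi>) \<mu>)"
  define S where "S = (\<Sum>j=1..N. (dist (\<xi> j) (\<eta> j))\<^sup>2) / N"
  have S0: "S \<ge> 0" by (simp add: S_def sum_nonneg)
  have p0: "p > 0" using p by auto
  have c_fin: "c \<xi> < \<top>" for \<xi>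
    unfolding c_def by (rule transport_cost_empirical_finite[OF assms])
  have W_c: "enn2real (wasserstein p (empirical N \<xi>) \<mu>) = enn2real (c \<xi>) powr (1 / p)" for \<xi>
    using c_fin[of \<xi>] by (simp add: wasserstein_def c_def less_top)
  have [measurable_cong]: "sets \<mu> = sets borel" by fact
  \<comment> \<open>The strict bounds leave room for a coupling that is only nearly optimal and for \<open>S = 0\<close>.\<close>
  have key: "enn2real (c \<xi>) powr (1 / p) \<le> a + r" if a: "sqrt S < a" and r: "enn2real (c \<eta>) powr (1 / p) < r" for a r
  proof -
    have pos: "a > 0" "r > 0"
      using a r S0 by (auto intro: le_less_trans[OF real_sqrt_ge_zero] le_less_trans[OF powr_ge_zero])
    have "enn2real (c \<eta>) = (enn2real (c \<eta>) powr (1 / p)) powr p"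
      using p0 by (simp add: powr_powr)
    also have "\<dots> < r powr p"
      using r p0 by (intro powr_less_mono2) auto
    finally have "c \<eta> < ennreal (r powr p)"
      using c_fin[of \<eta>] by (metis enn2real_nonneg ennreal_enn2real ennreal_lessI less_le_trans not_le powr_ge_zero)
    then obtain \<sigma> where \<sigma>: "\<sigma> \<in> couplings ?U \<mu>"
      and less: "(\<integral>\<^sup>+z. ennreal (dist (\<eta> (fst z)) (snd z) powr p) \<partial>\<sigma>) < ennreal (r powr p)"
      unfolding c_def transport_cost_empirical[OF N sets] INF_less_iff by blast
    have [measurable_cong]: "sets \<sigma> = sets (?U \<Otimes>\<^sub>M \<mu>)" using \<sigma> by (rule sets_coupling)
    have [measurable]: "(\<lambda>z. f (fst z)) \<in> borel_measurable \<sigma>" for f :: "nat \<Rightarrow> 'a"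
      by (rule measurable_compose[of fst \<sigma> ?U]) auto
    obtain A B C where ABC: "A \<ge> 0" "B \<ge> 0" "C \<ge> 0" "A + B * a\<^sup>2 + C * r powr p = (a + r) powr p"
      and bound: "\<And>u v e. 0 \<le> u \<Longrightarrow> 0 \<le> v \<Longrightarrow> 0 \<le> e \<Longrightarrow> u \<le> e + v \<Longrightarrow> u powr p \<le> A + B * e\<^sup>2 + C * v powr p"
      using powr_triangle_bound[OF p pos] by blast
    let ?e = "\<lambda>j. dist (\<xi> j) (\<eta> j)"
    have "c \<xi> \<le> (\<integral>\<^sup>+z. ennreal (dist (\<xi> (fst z)) (snd z) powr p) \<partial>\<sigma>)"
      unfolding c_def transport_cost_empirical[OF N sets] using \<sigma> by (rule INF_lower)
    also have "\<dots> \<le> (\<integral>\<^sup>+z. ennreal (A + B * (?e (fst z))\<^sup>2) + ennreal C * ennreal (dist (\<eta> (fst z)) (snd z) powr p) \<partial>\<sigma>)"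
    proof (rule nn_integral_mono)
      fix z
      have "dist (\<xi> (fst z)) (snd z) powr p \<le> A + B * (?e (fst z))\<^sup>2 + C * dist (\<eta> (fst z)) (snd z) powr p"
        by (rule bound) (auto intro: dist_triangle)
      then have "ennreal (dist (\<xi> (fst z)) (snd z) powr p)
          \<le> ennreal (A + B * (?e (fst z))\<^sup>2 + C * dist (\<eta> (fst z)) (snd z) powr p)"
        by (rule ennreal_leI)
      also have "\<dots> = ennreal (A + B * (?e (fst z))\<^sup>2) + ennreal C * ennreal (dist (\<eta> (fst z)) (snd z) powr p)"
        using ABC by (simp add: ennreal_plus ennreal_mult)
      finally show "ennreal (dist (\<xi> (fst z)) (snd z) powr p)
          \<le> ennreal (A + B * (?e (fst z))\<^sup>2) + ennreal C * ennreal (dist (\<eta> (fst z)) (snd z) powr p)" .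
    qed
    also have "\<dots> = (\<integral>\<^sup>+z. ennreal (A + B * (?e (fst z))\<^sup>2) \<partial>\<sigma>)
        + ennreal C * (\<integral>\<^sup>+z. ennreal (dist (\<eta> (fst z)) (snd z) powr p) \<partial>\<sigma>)"
      by (subst nn_integral_add) (auto simp: nn_integral_cmult)
    also have "(\<integral>\<^sup>+z. ennreal (A + B * (?e (fst z))\<^sup>2) \<partial>\<sigma>) = (\<integral>\<^sup>+j. ennreal (A + B * (?e j)\<^sup>2) \<partial>?U)"
      by (rule coupling_nn_integral(1)[OF \<sigma>]) simp
    also have "\<dots> = (\<Sum>j=1..N. ennreal (A + B * (?e j)\<^sup>2)) / of_nat N"
      using N by (subst nn_integral_pmf_of_set) (auto simp: ennreal_of_nat_eq_real_of_nat)
    also have "\<dots> = ennreal ((\<Sum>j=1..N. A + B * (?e j)\<^sup>2) / N)"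
      using N ABC by (subst sum_ennreal) (auto simp: divide_ennreal sum_nonneg ennreal_of_nat_eq_real_of_nat)
    also have "(\<Sum>j=1..N. A + B * (?e j)\<^sup>2) / N = A + B * S"
      using N by (simp add: S_def sum.distrib sum_distrib_left[symmetric] add_divide_distrib)
    also have "ennreal (A + B * S) + ennreal C * (\<integral>\<^sup>+z. ennreal (dist (\<eta> (fst z)) (snd z) powr p) \<partial>\<sigma>)
        \<le> ennreal (A + B * a\<^sup>2) + ennreal C * ennreal (r powr p)"
    proof (intro add_mono mult_left_mono ennreal_leI less_imp_le[OF less])
      show "S \<le> a\<^sup>2" using a by (intro sqrt_le_D) simp
    qed (use ABC in auto)
    also have "\<dots> = ennreal ((a + r) powr p)"
      using ABC by (simp add: ennreal_plus[symmetric] ennreal_mult[symmetric] del: ennreal_plus)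
    finally have "enn2real (c \<xi>) \<le> (a + r) powr p"
      by (simp add: enn2real_leI)
    then have "enn2real (c \<xi>) powr (1 / p) \<le> ((a + r) powr p) powr (1 / p)"
      using p0 by (intro powr_mono2) auto
    also have "\<dots> = a + r" using p0 pos by (simp add: powr_powr)
    finally show ?thesis .
  qed
  have "enn2real (c \<xi>) powr (1 / p) \<le> enn2real (c \<eta>) powr (1 / p) + sqrt S"
  proof (rule field_le_epsilon)
    fix e :: real assume "e > 0"
    then show "enn2real (c \<xi>) powr (1 / p) \<le> enn2real (c \<eta>) powr (1 / p) + sqrt S + e"
      using key[of "sqrt S + e / 2" "enn2real (c \<eta>) powr (1 / p) + e / 2"] by simp
  qed
  then show ?thesis by (simp add: W_c S_def real_sqrt_divide)
qed

text \<open>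
  Such a function is continuous for the product topology on the space of all functions, whose Borel
  sets are the product sigma-algebra because the index type is countable. The embedding of the
  product over \<open>I\<close> is measurable since the coordinates outside \<open>I\<close> are constantly \<open>undefined\<close>.
\<close>
lemma lipschitz_finitely_many_coordinates_measurable:
  fixes \<mu> :: "'a::polish_space measure" and F :: "('i::countable \<Rightarrow> 'a) \<Rightarrow> real"
  assumes sets: "sets \<mu> = sets borel" and "finite I"
    and lip: "\<And>x y. \<bar>F x - F y\<bar> \<le> L * sqrt (\<Sum>i\<in>I. (dist (x i) (y i))\<^sup>2)"
  shows "F \<in> borel_measurable (\<Pi>\<^sub>M i\<in>I. \<mu>)"
proof -
  have "continuous_on UNIV F"
    unfolding continuous_on_def
  proof
    fix x :: "'i \<Rightarrow> 'a"
    have "((\<lambda>y. L * sqrt (\<Sum>i\<in>I. (dist (y i) (x i))\<^sup>2)) \<longlongrightarrow> L * sqrt (\<Sum>i\<in>I. (dist (x i) (x i))\<^sup>2)) (at x)"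
    proof (intro tendsto_intros)
      fix i
      have "continuous_on UNIV (\<lambda>y::'i \<Rightarrow> 'a. y i)" by (rule continuous_on_product_coordinates)
      then show "((\<lambda>y. y i) \<longlongrightarrow> x i) (at x)" unfolding continuous_on_def by simp
    qed
    then have "((\<lambda>y. L * sqrt (\<Sum>i\<in>I. (dist (y i) (x i))\<^sup>2)) \<longlongrightarrow> 0) (at x)" by simp
    then have "((\<lambda>y. F y - F x) \<longlongrightarrow> 0) (at x)"
      by (rule Lim_null_comparison[rotated]) (use lip in auto)
    then show "(F \<longlongrightarrow> F x) (at x within UNIV)" by (simp add: LIM_zero_iff)
  qed
  then have "F \<in> borel_measurable borel" by (rule borel_measurable_continuous_onI)
  then have F: "F \<in> borel_measurable (\<Pi>\<^sub>M i\<in>UNIV. borel)"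
    by (simp add: measurable_cong_sets[OF sets_PiM_equal_borel])
  have "(\<lambda>x. x) \<in> measurable (\<Pi>\<^sub>M i\<in>I. \<mu>) (\<Pi>\<^sub>M i\<in>UNIV. borel)"
  proof (rule measurable_PiM_single')
    fix i :: 'i
    show "(\<lambda>x. x i) \<in> borel_measurable (\<Pi>\<^sub>M i\<in>I. \<mu>)"
    proof (cases "i \<in> I")
      case True
      then have "(\<lambda>x. x i) \<in> measurable (\<Pi>\<^sub>M i\<in>I. \<mu>) \<mu>" by (rule measurable_component_singleton)
      then show ?thesis by (simp add: measurable_cong_sets[OF refl sets])
    next
      case False
      have "(\<lambda>x. undefined) \<in> borel_measurable (\<Pi>\<^sub>M i\<in>I. \<mu>)" by simp
      then show ?thesis
        by (rule measurable_cong[THEN iffD1, rotated]) (use False in \<open>auto simp: space_PiM PiE_def extensional_def\<close>)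
    qed
  qed simp
  from measurable_compose[OF this F] show ?thesis by simp
qed

section \<open>Concentration of the empirical Wasserstein distance\<close>

theorem theorem4p3:
  fixes \<mu> :: "'a::polish_space measure" and \<alpha> p :: real and N :: nat
  assumes "radon_prob \<mu>"
    and "\<alpha> > 0"
    and "transport_T2 \<alpha> \<mu>"
    and "N \<ge> 1"
    and "p \<in> {1, 2}"
  defines "P \<equiv> \<Pi>\<^sub>M j\<in>{1..N}. \<mu>"
    and "W \<equiv> (\<lambda>\<xi>. wasserstein p (empirical N \<xi>) \<mu>)"
  shows "(\<forall>\<xi>\<in>space P. W \<xi> < \<top>) \<and>
    integrable P (\<lambda>\<xi>. enn2real (W \<xi>)) \<and>
    (\<forall>\<epsilon>>0. measure P {\<xi> \<in> space P. \<bar>enn2real (W \<xi>) - (\<integral>\<xi>'. enn2real (W \<xi>') \<partial>P)\<bar> > \<epsilon>}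
            \<le> 2 * exp (- (real N * \<alpha> * \<epsilon>\<^sup>2 / 2)))"
proof -
  have prob: "prob_space \<mu>" and sets: "sets \<mu> = sets borel"
    using assms(1) by (auto simp: radon_prob_def)
  interpret \<mu>: prob_space \<mu> by fact
  interpret product_prob_space "\<lambda>_. \<mu>" "{1..N}" by standard
  define F where "F = (\<lambda>\<xi>. enn2real (W \<xi>))"
  define L where "L = 1 / sqrt N"
  have L: "L > 0" using \<open>N \<ge> 1\<close> by (simp add: L_def)
  have le: "F \<xi> \<le> F \<eta> + L * sqrt (\<Sum>j\<in>{1..N}. (dist (\<xi> j) (\<eta> j))\<^sup>2)" for \<xi> \<eta>
    unfolding F_def L_def W_def by (rule wasserstein_empirical_le[OF assms(3) prob sets assms(4,5)])
  have lip: "\<bar>F \<xi> - F \<eta>\<bar> \<le> L * sqrt (\<Sum>j\<in>{1..N}. (dist (\<xi> j) (\<eta> j))\<^sup>2)" for \<xi> \<eta>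
    using le[of \<xi> \<eta>] le[of \<eta> \<xi>] by (simp add: dist_commute abs_le_iff)
  have F_meas[measurable]: "F \<in> borel_measurable P"
    unfolding P_def using sets _ lip by (rule lipschitz_finitely_many_coordinates_measurable) simp
  have int: "integrable P F"
  proof (rule Bochner_Integration.integrable_bound)
    fix x0 :: 'a
    let ?g = "\<lambda>\<xi>. F (\<lambda>_. x0) + L * (1 + (\<Sum>j\<in>{1..N}. (dist (\<xi> j) x0)\<^sup>2))"
    have "integrable \<mu> (\<lambda>x. (dist x x0)\<^sup>2)"
      using transport_T2_second_moment[OF assms(3) prob sets, of x0]
      by (intro integrableI_nonneg) (auto simp: dist_commute measurable_cong_sets[OF sets])
    then have "integrable P (\<lambda>\<xi>. (dist (\<xi> j) x0)\<^sup>2)" if "j \<in> {1..N}" for j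
      using that PiM_component[of j] integrable_distr[of "\<lambda>\<xi>. \<xi> j" P \<mu> "\<lambda>x. (dist x x0)\<^sup>2"]
      by (simp add: P_def)
    moreover have "integrable P (\<lambda>_. c)" for c :: real
      unfolding P_def by (rule P.integrable_const)
    ultimately show "integrable P ?g"
      by (intro Bochner_Integration.integrable_add integrable_mult_right Bochner_Integration.integrable_sum)
    show "AE \<xi> in P. norm (F \<xi>) \<le> norm (?g \<xi>)"
    proof (rule AE_I2)
      fix \<xi>
      define S where "S = (\<Sum>j\<in>{1..N}. (dist (\<xi> j) x0)\<^sup>2)"
      have S: "0 \<le> S" by (simp add: S_def sum_nonneg)
      then have "sqrt S \<le> 1 + S"
        using sum_squares_bound[of 1 "sqrt S"] by simp
      then have "L * sqrt S \<le> L * (1 + S)" using L by (intro mult_left_mono) auto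
      then show "norm (F \<xi>) \<le> norm (?g \<xi>)"
        using le[of \<xi> "\<lambda>_. x0"] enn2real_nonneg[of "W \<xi>"] by (simp add: F_def S_def)
    qed
  qed measurable
  have "W \<xi> < \<top>" for \<xi>
    using transport_cost_empirical_finite[OF assms(3) prob sets assms(4,5), of \<xi>]
    by (simp add: W_def wasserstein_def less_top[symmetric])
  moreover have "measure P {\<xi> \<in> space P. \<bar>F \<xi> - (\<integral>\<xi>'. F \<xi>' \<partial>P)\<bar> > \<epsilon>} \<le> 2 * exp (- (real N * \<alpha> * \<epsilon>\<^sup>2 / 2))"
    if "\<epsilon> > 0" for \<epsilon>
  proof -
    have eq: "\<alpha> * \<epsilon>\<^sup>2 / (2 * L\<^sup>2) = real N * \<alpha> * \<epsilon>\<^sup>2 / 2"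
      using \<open>N \<ge> 1\<close> by (simp add: L_def power_divide)
    show ?thesis
      unfolding P_def eq[symmetric]
      by (rule lipschitz_concentration[OF assms(3,2) prob sets _ int[unfolded P_def] L lip that]) simp
  qed
  ultimately show ?thesis using int by (simp add: F_def)
qed

end
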